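(* Let $A\in\mathbb{C}^{n\times n}$ ($n\ge 1$) be factorized as $A=Q\,\mathrm{diag}(J_1,\ldots,J_p)\,Q^{-1}$, where $Q\in\mathbb{C}^{n\times n}$ is nonsingular and each $J_i\in\mathbb{C}^{m_i\times m_i}$ ($\sum_{i=1}^p m_i=n$) is a Jordan block. Let $\widetilde{A}=A+E$ with $E\in\mathbb{C}^{n\times n}$ arbitrary. Let $\{\lambda_i\}_{i=1}^n$ and $\{\widetilde{\lambda}_i\}_{i=1}^n$ be the spectra of $A$ and $\widetilde{A}$, respectively. Put $m=\max_{1\le i\le p}m_i$ and $E_Q=Q^{-1}EQ$. Then there exists a permutation $\pi$ of $\{1,\ldots,n\}$ such that $$\Big(\sum_{i=1}^n|\widetilde{\lambda}_{\pi(i)}-\lambda_i|^2\Big)^{1/2}\le\begin{cases}\sqrt{n\Big(n-p+2\sqrt{n-p}\,\delta(E_Q)+\frac{\delta(E_Q)^2}{\|E_Q\|_F^2}\Big)\|E_Q\|_F^{2/m}+\frac1n|\mathrm{tr}(E)|^2}, & \text{if } \|E_Q\|_F<1,\\[2mm] \sqrt{n\big(\sqrt{n-p}+\delta(E_Q)\big)^2+\frac1n|\mathrm{tr}(E)|^2}, & \text{if } \|E_Q\|_F\ge 1.\end{cases}$$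
   Context: $\|\cdot\|_F$ is the Frobenius norm and $\mathrm{tr}$ the trace. For $Y\in\mathbb{C}^{n\times n}$, $\delta(Y):=\big(\|Y\|_F^2-\frac1n|\mathrm{tr}(Y)|^2\big)^{1/2}$. Spectra are listed with algebraic multiplicity (so each has exactly $n$ entries). A Jordan block of size $m_i$ is an upper bidiagonal $m_i\times m_i$ matrix with a constant complex number on the diagonal, ones on the first superdiagonal, and zeros elsewhere; blocks may share the same eigenvalue. When $E=0$, the quotient $\delta(E_Q)^2/\|E_Q\|_F^2$ is interpreted as $0$ (the right-hand side is then $0$). *)

theory Defs
  imports
    "HOL-Combinatorics.Permutations"
    "Jordan_Normal_Form.Char_Poly"
    "Jordan_Normal_Form.Jordan_Normal_Form"
begin

definition mat_trace :: "'a :: comm_monoid_add mat \<Rightarrow> 'a" where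
  "mat_trace A = (\<Sum>i<dim_row A. A $$ (i, i))"

definition frobenius_norm :: "complex mat \<Rightarrow> real" where
  "frobenius_norm A = sqrt (\<Sum>i<dim_row A. \<Sum>j<dim_col A. (cmod (A $$ (i, j)))\<^sup>2)"

text \<open>
  Intended for square matrices of size \<open>n \<ge> 1\<close>, where \<open>n\<close> is \<open>dim_row Y\<close>.
  The radicand is then nonnegative by Cauchy-Schwarz.
\<close>
definition mat_delta :: "complex mat \<Rightarrow> real" where
  "mat_delta Y = sqrt ((frobenius_norm Y)\<^sup>2 - (cmod (mat_trace Y))\<^sup>2 / real (dim_row Y))"

text \<open>
  The numbers \<open>ev 0, \<dots>, ev (n - 1)\<close>, where \<open>n\<close> is the size of the square matrix \<open>A\<close>,
  list the spectrum of \<open>A\<close>: each complex number occurs as often as its algebraic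
  multiplicity, i.e. its order as a root of the characteristic polynomial
  (so never, if it is not an eigenvalue).
  The values of \<open>ev\<close> at indices \<open>\<ge> n\<close> are irrelevant.
\<close>
definition lists_spectrum :: "(nat \<Rightarrow> complex) \<Rightarrow> complex mat \<Rightarrow> bool" where
  "lists_spectrum ev A \<longleftrightarrow>
     (\<forall>z. card {i. i < dim_row A \<and> ev i = z} = Polynomial.order z (char_poly A))"

end

theory Submission
  imports Defs "Jordan_Normal_Form.Schur_Decomposition" "HOL-Analysis.L2_Norm"
begin

text \<open>
  Let \<open>K = Q\<inverse> E Q\<close>, so that \<open>A\<close> and \<open>A + E\<close> are similar to a Jordan matrix \<open>J\<close> and to
  \<open>J + K\<close>. The eigenvalues of \<open>A\<close> stand on the diagonal \<open>\<Lambda>\<close> of \<open>J\<close>. Conjugation of \<open>J + K\<close> by a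
  diagonal matrix whose entry at position \<open>r\<close> of a block is \<open>e\<^sup>r\<close>, where \<open>0 < e \<le> 1\<close>, turns it
  into \<open>\<Lambda> + F\<close>: the \<open>n - p\<close> ones above the diagonal become \<open>e\<close>, and the entries of \<open>K\<close> grow
  at most by the factor \<open>e / e\<^sup>m\<close>. The entries of \<open>K\<close> that share their place with one of
  the ones are multiplied by exactly \<open>e\<close>, so the mixed term in \<open>\<delta>(F)\<^sup>2\<close> carries
  \<open>e\<^sup>2\<close> only, and Cauchy--Schwarz gives (lemma \<open>delta_sq_scaled_le\<close>)
  \<open>\<delta>(F)\<^sup>2 \<le> e\<^sup>2 (n - p + 2 sqrt (n - p) \<delta>(K) + \<delta>(K)\<^sup>2 / e\<^bsup>2m\<^esup>)\<close>. The choice \<open>e\<^sup>m = \<parallel>K\<parallel>\<close> yields the bound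
  for \<open>\<parallel>K\<parallel> < 1\<close>, and \<open>e = 1\<close> yields the other one. For \<open>K = 0\<close> the two spectra coincide.

  It remains to perturb the diagonal, hence normal, matrix \<open>\<Lambda>\<close> by an arbitrary \<open>F\<close>
  (\<open>diagonal_perturbation_spectrum\<close>): the squared distance of the spectra, optimally matched,
  is at most \<open>n \<delta>(F)\<^sup>2 + |tr F|\<^sup>2 / n\<close>. Write \<open>\<Lambda> + F = U R U\<^sup>*\<close> with \<open>U\<close> unitary and \<open>R\<close> upper triangular
  with diagonal part \<open>D\<close>, and let \<open>N = U\<^sup>* \<Lambda> U\<close>. Below the diagonal \<open>N\<close> equals \<open>- U\<^sup>* F U\<close>. Above the
  diagonal nothing is known about \<open>R\<close>, but \<open>N\<close> is normal, and the upper part of a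
  normal matrix is controlled by its lower part at the price of a factor \<open>n - 1\<close>
  (\<open>normal_upper_le_lower\<close>). This bounds \<open>\<parallel>N - D\<parallel>\<^sup>2\<close> by \<open>n \<parallel>F\<parallel>\<^sup>2\<close>. On the other hand \<open>\<parallel>N - D\<parallel>\<^sup>2\<close> is the sum
  of the costs \<open>|d\<^sub>j - \<lambda>\<^sub>i|\<^sup>2\<close> with the doubly stochastic weights \<open>|u\<^sub>i\<^sub>j|\<^sup>2\<close>, and
  some permutation does at least as well as any doubly stochastic weighting
  (\<open>optimal_assignment_le_doubly_stochastic\<close>); this is the Hoffman--Wielandt argument.
  Subtracting the mean \<open>c = tr F / n\<close> from \<open>F\<close> and \<open>D\<close> first replaces \<open>\<parallel>F\<parallel>\<close> by \<open>\<delta>(F)\<close>; the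
  mean of the eigenvalue differences is \<open>c\<close>, which accounts for the term \<open>|tr F|\<^sup>2 / n\<close>.
\<close>

section \<open>Hall's theorem and doubly stochastic weights\<close>

text \<open>
  Cardinality of neighbourhoods is submodular. If deleting \<open>a\<close> from
  \<open>N x\<close> breaks Hall's condition at \<open>P \<union> {x}\<close> and
  deleting \<open>b\<close> breaks it at \<open>Q \<union> {x}\<close>, then adding the
  two defects contradicts Hall's condition at \<open>P \<union> Q \<union> {x}\<close>
  and \<open>P \<inter> Q\<close>: at the former set nothing has been lost, because
  \<open>a \<noteq> b\<close>.
\<close>
lemma hall_deficient_union:
  assumes fin: "finite I" "\<And>i. i \<in> I \<Longrightarrow> finite (N i)"
    and hall: "\<And>J. J \<subseteq> I \<Longrightarrow> card J \<le> card (\<Union>(N ` J))"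
    and x: "x \<in> I" and ab: "a \<in> N x" "b \<in> N x" "a \<noteq> b"
    and P: "P \<subseteq> I - {x}" "card (\<Union>(N ` P) \<union> (N x - {a})) \<le> card P"
    and Q: "Q \<subseteq> I - {x}" "card (\<Union>(N ` Q) \<union> (N x - {b})) \<le> card Q"
  shows False
proof -
  let ?S = "\<Union>(N ` P) \<union> (N x - {a})" and ?T = "\<Union>(N ` Q) \<union> (N x - {b})"
  have finP: "finite P" "finite Q" using P(1) Q(1) fin(1) by (meson Diff_subset finite_subset)+
  have finS: "finite ?S" "finite ?T"
    using P(1) Q(1) fin x finP by auto
  have "?S \<union> ?T = \<Union>(N ` insert x (P \<union> Q))" using ab by auto
  moreover have "card (insert x (P \<union> Q)) \<le> card (\<Union>(N ` insert x (P \<union> Q)))"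
    using hall[of "insert x (P \<union> Q)"] x P(1) Q(1) by blast
  moreover have "card (insert x (P \<union> Q)) = Suc (card (P \<union> Q))"
    using finP P(1) Q(1) by (intro card_insert_disjoint) auto
  moreover have "card (P \<inter> Q) \<le> card (\<Union>(N ` (P \<inter> Q)))" using hall[of "P \<inter> Q"] P(1) by blast
  moreover have "card (\<Union>(N ` (P \<inter> Q))) \<le> card (?S \<inter> ?T)"
    using finS by (intro card_mono) auto
  moreover have "card ?S + card ?T = card (?S \<union> ?T) + card (?S \<inter> ?T)"
    by (rule card_Un_Int[OF finS])
  moreover have "card P + card Q = card (P \<union> Q) + card (P \<inter> Q)"
    by (rule card_Un_Int[OF finP])
  ultimately show False using P(2) Q(2) by simp
qed

text \<open>
  Rado's proof: by the preceding lemma, as long as some \<open>N x\<close> has two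
  elements, one of them can be deleted without violating Hall's condition. When all sets
  are singletons, Hall's condition for pairs says that they are distinct.
\<close>
theorem hall_marriage:
  assumes "finite I" "\<And>i. i \<in> I \<Longrightarrow> finite (N i)"
    and "\<And>J. J \<subseteq> I \<Longrightarrow> card J \<le> card (\<Union>(N ` J))"
  shows "\<exists>f. inj_on f I \<and> (\<forall>i\<in>I. f i \<in> N i)"
  using assms
proof (induction "\<Sum>i\<in>I. card (N i)" arbitrary: N rule: less_induct)
  case (less N)
  note fin = less.prems(1,2) and hall = less.prems(3)
  have ne: "N i \<noteq> {}" if "i \<in> I" for i using hall[of "{i}"] that by auto
  show ?case
  proof (cases "\<exists>x\<in>I. \<exists>a\<in>N x. \<exists>b\<in>N x. a \<noteq> b")
    case False
    define f where "f i = (SOME a. a \<in> N i)" for i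
    have f: "f i \<in> N i" if "i \<in> I" for i unfolding f_def using ne[OF that] by (simp add: some_in_eq)
    have Nf: "N i = {f i}" if "i \<in> I" for i using f[OF that] False that by blast
    have "inj_on f I"
    proof (rule inj_onI, rule ccontr)
      fix i j assume ij: "i \<in> I" "j \<in> I" "f i = f j" "i \<noteq> j"
      have "card {i, j} \<le> card (\<Union>(N ` {i, j}))" using hall[of "{i, j}"] ij by blast
      with ij Nf[of i] Nf[of j] show False by simp
    qed
    with f show ?thesis by blast
  next
    case True
    then obtain x a b where x: "x \<in> I" and ab: "a \<in> N x" "b \<in> N x" "a \<noteq> b" by blast
    \<comment> \<open>deleting \<open>c\<close> is harmless when no set containing \<open>x\<close> becomes deficient\<close>
    have shrink: "\<exists>f. inj_on f I \<and> (\<forall>i\<in>I. f i \<in> N i)"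
      if c: "c \<in> N x" and h: "\<And>P. P \<subseteq> I - {x} \<Longrightarrow> card P < card (\<Union>(N ` P) \<union> (N x - {c}))" for c
    proof -
      let ?N = "N(x := N x - {c})"
      have fin': "finite (?N i)" if "i \<in> I" for i using fin(2) that by auto
      have smaller: "(\<Sum>i\<in>I. card (?N i)) < (\<Sum>i\<in>I. card (N i))"
      proof (rule sum_strict_mono_ex1[OF fin(1)])
        show "\<forall>i\<in>I. card (?N i) \<le> card (N i)" using fin by (auto intro: card_mono)
        show "\<exists>i\<in>I. card (?N i) < card (N i)"
          using x card_Diff1_less[OF fin(2)[OF x] c] by (intro bexI[of _ x]) simp_all
      qed
      have hall': "card J \<le> card (\<Union>(?N ` J))" if J: "J \<subseteq> I" for J
      proof (cases "x \<in> J")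
        case True
        have "finite (J - {x})" using J fin(1) finite_subset by blast
        then have "card J = Suc (card (J - {x}))"
          using True by (metis card_insert_disjoint Diff_iff insertI1 insert_Diff)
        moreover have "\<Union>(?N ` J) = \<Union>(N ` (J - {x})) \<union> (N x - {c})" using True by auto
        moreover have "J - {x} \<subseteq> I - {x}" using J by auto
        ultimately show ?thesis using h[of "J - {x}"] by simp
      next
        case False
        then have "\<Union>(?N ` J) = \<Union>(N ` J)" by auto
        then show ?thesis using hall[OF J] by simp
      qed
      obtain f where "inj_on f I" "\<forall>i\<in>I. f i \<in> ?N i"
        using less.hyps[OF smaller fin(1) fin' hall'] by blast
      moreover from this have "\<forall>i\<in>I. f i \<in> N i" by (auto split: if_splits)
      ultimately show ?thesis by blast
    qed
    show ?thesis
    proof (rule ccontr)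
      assume no: "\<not> ?thesis"
      obtain P where "P \<subseteq> I - {x}" "card (\<Union>(N ` P) \<union> (N x - {a})) \<le> card P"
        using shrink[OF ab(1)] no by (meson not_le)
      moreover obtain Q where "Q \<subseteq> I - {x}" "card (\<Union>(N ` Q) \<union> (N x - {b})) \<le> card Q"
        using shrink[OF ab(2)] no by (meson not_le)
      ultimately show False using hall_deficient_union[OF fin hall x ab] by blast
    qed
  qed
qed

text \<open>
  Hall's condition for the support of \<open>w\<close> holds because the rows in
  \<open>J\<close> carry the total weight \<open>s |J|\<close>, all of it in the columns
  that meet the support, and these carry at most \<open>s\<close> each.
\<close>
lemma positive_transversal:
  fixes w :: "nat \<Rightarrow> nat \<Rightarrow> real"
  assumes nn: "\<And>i j. i < n \<Longrightarrow> j < n \<Longrightarrow> 0 \<le> w i j"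
    and row: "\<And>i. i < n \<Longrightarrow> (\<Sum>j<n. w i j) = s"
    and col: "\<And>j. j < n \<Longrightarrow> (\<Sum>i<n. w i j) = s"
    and s: "0 < s"
  shows "\<exists>\<sigma>. \<sigma> permutes {..<n} \<and> (\<forall>i<n. 0 < w i (\<sigma> i))"
proof -
  define N where "N i = {j. j < n \<and> 0 < w i j}" for i
  have "card J \<le> card (\<Union>(N ` J))" if J: "J \<subseteq> {..<n}" for J
  proof -
    let ?K = "\<Union>(N ` J)"
    have K: "?K \<subseteq> {..<n}" by (auto simp: N_def)
    have finJ: "finite J" using J finite_subset by blast
    have "s * card J = (\<Sum>i\<in>J. \<Sum>j<n. w i j)" using J row by (simp add: subset_iff)
    also have "\<dots> = (\<Sum>i\<in>J. \<Sum>j\<in>?K. w i j)"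
    proof (rule sum.cong[OF refl], rule sum.mono_neutral_right)
      fix i assume i: "i \<in> J"
      show "\<forall>j\<in>{..<n} - ?K. w i j = 0"
      proof
        fix j assume j: "j \<in> {..<n} - ?K"
        with i have "\<not> 0 < w i j" by (auto simp: N_def)
        with nn[of i j] i j J show "w i j = 0" by auto
      qed
    qed (use K in auto)
    also have "\<dots> = (\<Sum>j\<in>?K. \<Sum>i\<in>J. w i j)" by (rule sum.swap)
    also have "\<dots> \<le> (\<Sum>j\<in>?K. \<Sum>i<n. w i j)"
      using J K nn by (intro sum_mono sum_mono2) auto
    also have "\<dots> = s * card ?K" using K col by (simp add: subset_iff)
    finally show ?thesis using s by simp
  qed
  then obtain f where f: "inj_on f {..<n}" "\<forall>i\<in>{..<n}. f i \<in> N i"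
    using hall_marriage[of "{..<n}" N] by (auto simp: N_def)
  define \<sigma> where "\<sigma> i = (if i < n then f i else i)" for i
  have "\<sigma> permutes {..<n}"
  proof (rule bij_imp_permutes)
    have "inj_on \<sigma> {..<n}" using f(1) by (simp add: inj_on_def \<sigma>_def)
    moreover have "\<sigma> ` {..<n} \<subseteq> {..<n}" using f(2) by (auto simp: \<sigma>_def N_def)
    ultimately show "bij_betw \<sigma> {..<n} {..<n}"
      by (simp add: bij_betw_def endo_inj_surj)
  qed (simp add: \<sigma>_def)
  moreover have "\<forall>i<n. 0 < w i (\<sigma> i)" using f(2) by (auto simp: \<sigma>_def N_def)
  ultimately show ?thesis by blast
qed

text \<open>
  One step of Birkhoff's decomposition: subtract from \<open>w\<close> the largest
  possible multiple \<open>t\<close> of a permutation matrix contained in its support.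
  The rest has fewer positive entries and line sums \<open>s - t\<close>; the cheaper of
  the subtracted permutation and the one found for the rest satisfies the claim.
  Carrying the line sum \<open>s\<close> as a parameter avoids renormalisation.
\<close>
theorem optimal_assignment_le_doubly_stochastic:
  fixes w c :: "nat \<Rightarrow> nat \<Rightarrow> real"
  assumes "\<And>i j. i < n \<Longrightarrow> j < n \<Longrightarrow> 0 \<le> w i j"
    and "\<And>i. i < n \<Longrightarrow> (\<Sum>j<n. w i j) = s"
    and "\<And>j. j < n \<Longrightarrow> (\<Sum>i<n. w i j) = s"
    and "0 \<le> s"
  shows "\<exists>\<sigma>. \<sigma> permutes {..<n} \<and> s * (\<Sum>i<n. c i (\<sigma> i)) \<le> (\<Sum>i<n. \<Sum>j<n. w i j * c i j)"
  using assms
proof (induction "card {(i, j). i < n \<and> j < n \<and> 0 < w i j}" arbitrary: w s rule: less_induct)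
  case (less w s)
  note nn = less.prems(1) and row = less.prems(2) and col = less.prems(3)
  show ?case
  proof (cases "n = 0 \<or> s = 0")
    case True
    have "w i j = 0" if "i < n" "j < n" for i j
    proof -
      have "w i j \<le> (\<Sum>j<n. w i j)" using that nn by (intro member_le_sum) auto
      with True nn[OF that] row[OF that(1)] that show ?thesis by auto
    qed
    then have "s * (\<Sum>i<n. c i (id i)) \<le> (\<Sum>i<n. \<Sum>j<n. w i j * c i j)" using True by auto
    then show ?thesis using permutes_id by blast
  next
    case False
    then have n: "0 < n" and s: "0 < s" using less.prems(4) by auto
    obtain \<sigma> where \<sigma>: "\<sigma> permutes {..<n}" and pos: "\<And>i. i < n \<Longrightarrow> 0 < w i (\<sigma> i)"
      using positive_transversal[OF nn row col s] by blast
    have \<sigma>n: "\<sigma> i < n \<longleftrightarrow> i < n" for i using permutes_in_image[OF \<sigma>] by simp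
    \<comment> \<open>the minimum makes \<open>v\<close> below vanish at \<open>(k, \<sigma> k)\<close> and stay nonnegative elsewhere\<close>
    define t where "t = Min ((\<lambda>i. w i (\<sigma> i)) ` {..<n})"
    have t_le: "t \<le> w i (\<sigma> i)" if "i < n" for i unfolding t_def using that by (intro Min_le) auto
    have "t \<in> (\<lambda>i. w i (\<sigma> i)) ` {..<n}" unfolding t_def using n by (intro Min_in) auto
    then obtain k where k: "k < n" "t = w k (\<sigma> k)" by auto
    have t: "0 < t" using k pos by simp
    define v where "v i j = w i j - (if \<sigma> i = j then t else 0)" for i j
    have v_nn: "0 \<le> v i j" if "i < n" "j < n" for i j
      using nn[OF that] t_le[OF that(1)] by (auto simp: v_def)
    have v_row: "(\<Sum>j<n. v i j) = s - t" if "i < n" for i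
      using row[OF that] \<sigma>n[of i] that by (simp add: v_def sum_subtractf)
    have v_col: "(\<Sum>i<n. v i j) = s - t" if "j < n" for j
    proof -
      have "(\<Sum>i<n. if \<sigma> i = j then t else 0) = (\<Sum>i<n. if i = j then t else 0)"
        using sum.permute[OF \<sigma>, of "\<lambda>i. if i = j then t else 0"] by (simp add: comp_def)
      then show ?thesis using col[OF that] that by (simp add: v_def sum_subtractf)
    qed
    have "t \<le> (\<Sum>j<n. w k j)"
      unfolding k(2) using k(1) nn \<sigma>n by (intro member_le_sum) auto
    then have st: "0 \<le> s - t" using row[OF k(1)] by simp
    have "card {(i, j). i < n \<and> j < n \<and> 0 < v i j} < card {(i, j). i < n \<and> j < n \<and> 0 < w i j}"
    proof (rule psubset_card_mono)
      show "finite {(i, j). i < n \<and> j < n \<and> 0 < w i j}"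
        by (rule finite_subset[of _ "{..<n} \<times> {..<n}"]) auto
      have "(k, \<sigma> k) \<in> {(i, j). i < n \<and> j < n \<and> 0 < w i j} - {(i, j). i < n \<and> j < n \<and> 0 < v i j}"
        using k pos \<sigma>n by (auto simp: v_def)
      moreover have "{(i, j). i < n \<and> j < n \<and> 0 < v i j} \<subseteq> {(i, j). i < n \<and> j < n \<and> 0 < w i j}"
        using t by (auto simp: v_def split: if_splits)
      ultimately show "{(i, j). i < n \<and> j < n \<and> 0 < v i j} \<subset> {(i, j). i < n \<and> j < n \<and> 0 < w i j}"
        by blast
    qed
    from less.hyps[OF this v_nn v_row v_col st]
    obtain \<tau> where \<tau>: "\<tau> permutes {..<n}"
      "(s - t) * (\<Sum>i<n. c i (\<tau> i)) \<le> (\<Sum>i<n. \<Sum>j<n. v i j * c i j)" by blast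
    have "(\<Sum>i<n. \<Sum>j<n. v i j * c i j)
        = (\<Sum>i<n. \<Sum>j<n. w i j * c i j) - (\<Sum>i<n. \<Sum>j<n. if \<sigma> i = j then t * c i j else 0)"
      by (simp add: v_def left_diff_distrib sum_subtractf if_distrib[of "\<lambda>x. x * _"] cong: if_cong)
    also have "(\<Sum>i<n. \<Sum>j<n. if \<sigma> i = j then t * c i j else 0) = t * (\<Sum>i<n. c i (\<sigma> i))"
      using \<sigma>n by (simp add: sum_distrib_left)
    finally have le: "(s - t) * (\<Sum>i<n. c i (\<tau> i)) + t * (\<Sum>i<n. c i (\<sigma> i))
        \<le> (\<Sum>i<n. \<Sum>j<n. w i j * c i j)" using \<tau>(2) by simp
    show ?thesis
    proof (cases "(\<Sum>i<n. c i (\<tau> i)) \<le> (\<Sum>i<n. c i (\<sigma> i))")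
      case True
      then have "t * (\<Sum>i<n. c i (\<tau> i)) \<le> t * (\<Sum>i<n. c i (\<sigma> i))" using t by simp
      then have "s * (\<Sum>i<n. c i (\<tau> i)) \<le> (\<Sum>i<n. \<Sum>j<n. w i j * c i j)"
        using le by (simp add: algebra_simps)
      then show ?thesis using \<tau>(1) by blast
    next
      case False
      then have "(s - t) * (\<Sum>i<n. c i (\<sigma> i)) \<le> (s - t) * (\<Sum>i<n. c i (\<tau> i))"
        using st by (intro mult_left_mono) auto
      then have "s * (\<Sum>i<n. c i (\<sigma> i)) \<le> (\<Sum>i<n. \<Sum>j<n. w i j * c i j)"
        using le by (simp add: algebra_simps)
      then show ?thesis using \<sigma> by blast
    qed
  qed
qed

section \<open>Unitary triangularisation\<close>

lemma mat_adjoint_eq: "mat_adjoint A = mat (dim_col A) (dim_row A) (\<lambda>(i, j). conjugate (A $$ (j, i)))"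
  by (rule eq_matI) (auto simp: mat_adjoint_def mat_of_rows_def)

lemma mat_adjoint_index [simp]:
  "i < dim_col A \<Longrightarrow> j < dim_row A \<Longrightarrow> mat_adjoint A $$ (i, j) = conjugate (A $$ (j, i))"
  by (simp add: mat_adjoint_eq)

lemma mat_adjoint_dim [simp]:
  "dim_row (mat_adjoint A) = dim_col A" "dim_col (mat_adjoint A) = dim_row A"
  by (simp_all add: mat_adjoint_eq)

lemma mat_adjoint_carrier [simp, intro]:
  "A \<in> carrier_mat n m \<Longrightarrow> mat_adjoint A \<in> carrier_mat m n"
  by (auto simp: mat_adjoint_eq)

lemma mat_adjoint_adjoint [simp]: "mat_adjoint (mat_adjoint A) = A"
  by (rule eq_matI) auto

lemma mat_adjoint_mult:
  fixes A B :: "'a :: conjugatable_field mat"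
  assumes "A \<in> carrier_mat n m" "B \<in> carrier_mat m k"
  shows "mat_adjoint (A * B) = mat_adjoint B * mat_adjoint A"
proof (rule eq_matI)
  fix i j assume ij: "i < dim_row (mat_adjoint B * mat_adjoint A)" "j < dim_col (mat_adjoint B * mat_adjoint A)"
  have "conjugate (\<Sum>l<m. A $$ (j, l) * B $$ (l, i)) = (\<Sum>l<m. conjugate (B $$ (l, i)) * conjugate (A $$ (j, l)))"
    by (simp add: sum_conjugate conjugate_dist_mul mult.commute)
  then show "mat_adjoint (A * B) $$ (i, j) = (mat_adjoint B * mat_adjoint A) $$ (i, j)"
    using assms ij by (auto simp: scalar_prod_def atLeast0LessThan)
qed (use assms in auto)

definition unitary_mat :: "nat \<Rightarrow> complex mat \<Rightarrow> bool" where
  "unitary_mat n U \<longleftrightarrow> U \<in> carrier_mat n n \<and> mat_adjoint U * U = 1\<^sub>m n"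

lemma unitary_matD:
  assumes "unitary_mat n U"
  shows "U \<in> carrier_mat n n" "mat_adjoint U * U = 1\<^sub>m n" "U * mat_adjoint U = 1\<^sub>m n"
  using assms mat_mult_left_right_inverse[of "mat_adjoint U" n U] by (auto simp: unitary_mat_def)

lemma unitary_mat_mult:
  assumes U: "unitary_mat n U" and V: "unitary_mat n V"
  shows "unitary_mat n (U * V)"
proof -
  note u = unitary_matD[OF U] and v = unitary_matD[OF V]
  have "mat_adjoint U * (U * V) = V"
    using u v(1) assoc_mult_mat[of "mat_adjoint U" n n U n V n] by simp
  then have "mat_adjoint (U * V) * (U * V) = 1\<^sub>m n"
    using u(1) v by (simp add: mat_adjoint_mult[of _ n n _ n] assoc_mult_mat[of _ n n _ n _ n])
  then show ?thesis using u v by (simp add: unitary_mat_def)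
qed

text \<open>
  Complete \<open>v\<close> to a basis, orthogonalise with \<open>v\<close> in first
  place, and divide each column by its length.
\<close>
lemma unitary_mat_with_first_column:
  assumes v: "v \<in> carrier_vec n" "v \<noteq> 0\<^sub>v n"
  shows "\<exists>W a. unitary_mat n W \<and> col W 0 = a \<cdot>\<^sub>v v"
proof -
  interpret cof_vec_space n "TYPE(complex)" .
  define b where "b = basis_completion v"
  define ws where "ws = gram_schmidt n b"
  from basis_completion[OF v, folded b_def]
  have dist_b: "distinct b" and indep: "\<not> lin_dep (set b)" and b: "set b \<subseteq> carrier_vec n"
    and hdb: "hd b = v" and len_b: "length b = n" by auto
  from v have n: "0 < n" by (cases n) (auto simp: vec_eq_iff)
  from hdb len_b n obtain vs where bv: "b = v # vs" by (cases b, auto)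
  from gram_schmidt_result[OF b dist_b indep refl, folded ws_def]
  have ws: "set ws \<subseteq> carrier_vec n" "corthogonal ws" "length ws = n" by (auto simp: len_b)
  from gram_schmidt_hd[OF v(1), of vs, folded bv] have "hd ws = v" unfolding ws_def .
  then have ws0: "ws ! 0 = v" using ws(3) n by (metis hd_conv_nth length_0_conv less_irrefl)
  have wsi: "dim_vec (ws ! i) = n" if "i < n" for i
    using ws(1,3) that nth_mem[of i ws] by (auto simp: subset_iff)
  define r where "r i = sqrt (\<Sum>k<n. (cmod (ws ! i $ k))\<^sup>2)" for i
  have sp: "(\<Sum>k<n. cnj (ws ! i $ k) * ws ! j $ k) = ws ! j \<bullet>c ws ! i" if "i < n" "j < n" for i j
    using wsi[OF that(1)] wsi[OF that(2)]
    by (auto simp: scalar_prod_def atLeast0LessThan mult.commute intro!: sum.cong)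
  have sq: "(\<Sum>k<n. cnj (ws ! i $ k) * ws ! i $ k) = of_real (r i) ^ 2" for i
  proof -
    have "cnj z * z = of_real ((cmod z)\<^sup>2)" for z by (metis complex_norm_square mult.commute)
    then show ?thesis
      unfolding r_def of_real_power[symmetric] by (simp add: sum_nonneg del: of_real_power)
  qed
  define W where "W = mat n n (\<lambda>(k, i). ws ! i $ k / of_real (r i))"
  have "mat_adjoint W * W = 1\<^sub>m n"
  proof (rule eq_matI)
    fix i j assume "i < dim_row (1\<^sub>m n :: complex mat)" "j < dim_col (1\<^sub>m n :: complex mat)"
    then have ij: "i < n" "j < n" by auto
    have "(mat_adjoint W * W) $$ (i, j) =
        (\<Sum>k<n. cnj (ws ! i $ k) * ws ! j $ k / (of_real (r i) * of_real (r j)))"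
      using ij by (simp add: W_def scalar_prod_def atLeast0LessThan)
    also have "\<dots> = (\<Sum>k<n. cnj (ws ! i $ k) * ws ! j $ k) / (of_real (r i) * of_real (r j))"
      by (simp add: sum_divide_distrib)
    also have "\<dots> = (if i = j then 1 else 0)"
    proof (cases "i = j")
      case True
      have "ws ! i \<bullet>c ws ! i \<noteq> 0" using corthogonalD[OF ws(2), of i i] ij ws(3) by auto
      then have "r i \<noteq> 0" using sp[OF ij(1) ij(1)] sq[of i] by auto
      then show ?thesis using True sq[of i] by (simp add: power2_eq_square)
    next
      case False
      then have "ws ! j \<bullet>c ws ! i = 0" using corthogonalD[OF ws(2), of j i] ij ws(3) by auto
      then show ?thesis using False sp[OF ij] by simp
    qed
    finally show "(mat_adjoint W * W) $$ (i, j) = 1\<^sub>m n $$ (i, j)" using ij by simp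
  qed (auto simp: W_def)
  then have "unitary_mat n W" by (simp add: unitary_mat_def W_def)
  moreover have "col W 0 = (1 / of_real (r 0)) \<cdot>\<^sub>v v"
    using n v(1) by (auto simp: W_def ws0)
  ultimately show ?thesis by blast
qed

text \<open>
  Schur triangularisation, with a transformation that is unitary and therefore preserves
  the Frobenius norm. A unitary matrix whose first column is an eigenvector splits off
  the eigenvalue; the induction hypothesis handles the remaining block.
\<close>
theorem unitary_schur:
  fixes A :: "complex mat"
  assumes "A \<in> carrier_mat n n"
  shows "\<exists>U R. unitary_mat n U \<and> R \<in> carrier_mat n n \<and> upper_triangular R \<and> A = U * R * mat_adjoint U"
  using assms
proof (induction n arbitrary: A)
  case 0
  then show ?case
    by (intro exI[of _ "1\<^sub>m 0"] exI[of _ A]) (auto simp: unitary_mat_def intro!: eq_matI)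
next
  case (Suc n A)
  let ?N = "Suc n"
  note A = Suc.prems
  obtain as where as: "char_poly A = (\<Prod>a\<leftarrow>as. [:- a, 1:])" "length as = ?N"
    using char_poly_factorized[OF A] by auto
  then obtain e where "poly (char_poly A) e = 0" by (cases as) auto
  then obtain v where "eigenvector A v e"
    using eigenvalue_root_char_poly[OF A] by (auto simp: eigenvalue_def)
  then have v: "v \<in> carrier_vec ?N" "v \<noteq> 0\<^sub>v ?N" and Av: "A *\<^sub>v v = e \<cdot>\<^sub>v v"
    using A by (auto simp: eigenvector_def)
  obtain W a where W: "unitary_mat ?N W" and col: "col W 0 = a \<cdot>\<^sub>v v"
    using unitary_mat_with_first_column[OF v] by blast
  note w = unitary_matD[OF W]
  define A' where "A' = mat_adjoint W * (A * W)"
  have A': "A' \<in> carrier_mat ?N ?N" using w(1) A by (auto simp: A'_def)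
  \<comment> \<open>\<open>A\<close> maps the first column of \<open>W\<close> to \<open>e\<close> times itself, so \<open>A'\<close> has first column \<open>(e, 0, \<dots>, 0)\<close>\<close>
  have Acol: "col (A * W) 0 = e \<cdot>\<^sub>v col W 0"
  proof -
    have "col (A * W) 0 = A *\<^sub>v (a \<cdot>\<^sub>v v)" using col_mult2[OF A w(1), of 0] by (simp only: col zero_less_Suc)
    also have "\<dots> = e \<cdot>\<^sub>v col W 0"
      using A v(1) col by (simp add: mult_mat_vec[of _ ?N ?N] Av smult_smult_assoc mult.commute)
    finally show ?thesis .
  qed
  have colW: "col W 0 \<in> carrier_vec ?N" using w(1) by (auto intro!: carrier_vecI)
  have "col A' 0 = mat_adjoint W *\<^sub>v (e \<cdot>\<^sub>v col W 0)"
    unfolding A'_def using w(1) A Acol by (subst col_mult2[of _ ?N ?N _ ?N]) auto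
  also have "\<dots> = e \<cdot>\<^sub>v col (mat_adjoint W * W) 0"
    using w(1) colW by (subst mult_mat_vec[of _ ?N ?N]) (auto simp: col_mult2[of _ ?N ?N _ ?N])
  finally have A'col: "col A' 0 = e \<cdot>\<^sub>v unit_vec ?N 0" unfolding w(2) by simp
  have A'0: "A' $$ (i, 0) = (if i = 0 then e else 0)" if "i < ?N" for i
  proof -
    have "A' $$ (i, 0) = col A' 0 $ i" using that A' by simp
    then show ?thesis unfolding A'col using that by (simp add: unit_vec_def)
  qed
  define a2 where "a2 = mat 1 n (\<lambda>(i, j). A' $$ (0, Suc j))"
  define a3 where "a3 = mat n n (\<lambda>(i, j). A' $$ (Suc i, Suc j))"
  have A'_block: "A' = four_block_mat (e \<cdot>\<^sub>m 1\<^sub>m 1) a2 (0\<^sub>m n 1) a3"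
    using A' A'0 by (intro eq_matI) (auto simp: a2_def a3_def)
  have carr: "a2 \<in> carrier_mat 1 n" "a3 \<in> carrier_mat n n" by (auto simp: a2_def a3_def)
  obtain U3 R3 where U3: "unitary_mat n U3" and R3: "R3 \<in> carrier_mat n n" "upper_triangular R3"
    and a3: "a3 = U3 * R3 * mat_adjoint U3" using Suc.IH[OF carr(2)] by blast
  note u3 = unitary_matD[OF U3]
  define P where "P = four_block_mat (1\<^sub>m 1) (0\<^sub>m 1 n) (0\<^sub>m n 1) U3"
  define R where "R = four_block_mat (e \<cdot>\<^sub>m 1\<^sub>m 1) (a2 * U3) (0\<^sub>m n 1) R3"
  have P: "P \<in> carrier_mat ?N ?N" and R: "R \<in> carrier_mat ?N ?N"
    using u3(1) R3(1) by (auto simp: P_def R_def)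
  have adjP: "mat_adjoint P = four_block_mat (1\<^sub>m 1) (0\<^sub>m 1 n) (0\<^sub>m n 1) (mat_adjoint U3)"
    using u3(1) by (intro eq_matI) (auto simp: P_def)
  have one: "1\<^sub>m ?N = four_block_mat (1\<^sub>m 1) (0\<^sub>m 1 n) (0\<^sub>m n 1) (1\<^sub>m n :: complex mat)" by simp
  have "mat_adjoint P * P = 1\<^sub>m ?N"
    unfolding adjP unfolding P_def one
    by (subst mult_four_block_mat[of _ 1 1 _ n _ n _ _ 1 _ n]) (use u3 in auto)
  then have unP: "unitary_mat ?N P" using P by (simp add: unitary_mat_def)
  have "P * R = four_block_mat (e \<cdot>\<^sub>m 1\<^sub>m 1) (a2 * U3) (0\<^sub>m n 1) (U3 * R3)"
    unfolding P_def R_def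
    by (subst mult_four_block_mat[of _ 1 1 _ n _ n _ _ 1 _ n]) (use u3(1) R3(1) carr in auto)
  then have "P * R * mat_adjoint P = four_block_mat (e \<cdot>\<^sub>m 1\<^sub>m 1) (a2 * U3 * mat_adjoint U3) (0\<^sub>m n 1) (U3 * R3 * mat_adjoint U3)"
    unfolding adjP
    by (simp, subst mult_four_block_mat[of _ 1 1 _ n _ n _ _ 1 _ n]) (use u3(1) R3(1) carr in auto)
  also have "a2 * U3 * mat_adjoint U3 = a2"
    using carr(1) u3 by (simp add: assoc_mult_mat[of _ 1 n _ n _ n])
  finally have PRP: "P * R * mat_adjoint P = A'" using A'_block a3 by simp
  have "upper_triangular R" unfolding R_def
    by (rule upper_triangular_four_block) (use R3 in auto)
  moreover have "A = (W * P) * R * mat_adjoint (W * P)"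
  proof -
    have "(W * P) * R * mat_adjoint (W * P) = W * (P * R * mat_adjoint P) * mat_adjoint W"
      using w(1) P R by (simp add: mat_adjoint_mult[of _ ?N ?N _ ?N] assoc_mult_mat[of _ ?N ?N _ ?N _ ?N] mult_carrier_mat[of _ ?N ?N _ ?N])
    also have "\<dots> = (W * mat_adjoint W) * A * (W * mat_adjoint W)"
      using w(1) A by (simp add: PRP A'_def assoc_mult_mat[of _ ?N ?N _ ?N _ ?N] mult_carrier_mat[of _ ?N ?N _ ?N])
    finally show ?thesis using w(3) A by simp
  qed
  ultimately show ?case using unitary_mat_mult[OF W unP] R by blast
qed

section \<open>Spectra, Frobenius norm and trace\<close>

lemma order_linear_factor:
  fixes a z :: "'a :: idom"
  shows "Polynomial.order z [:- a, 1:] = (if a = z then 1 else 0)"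
proof (cases "a = z")
  case True
  then show ?thesis using order_power_n_n[of z 1] by simp
next
  case False
  then show ?thesis by (auto intro!: order_0I)
qed

lemma order_prod_linear_factors:
  fixes d :: "nat \<Rightarrow> 'a :: idom"
  shows "Polynomial.order z (\<Prod>i<n. [:- d i, 1:]) = card {i. i < n \<and> d i = z}"
proof (induction n)
  case (Suc n)
  have "{i. i < Suc n \<and> d i = z} = (if d n = z then {n} else {}) \<union> {i. i < n \<and> d i = z}"
    by (auto simp: less_Suc_eq)
  then have "card {i. i < Suc n \<and> d i = z} = (if d n = z then 1 else 0) + card {i. i < n \<and> d i = z}"
    by auto
  moreover have nz: "(\<Prod>i<n. [:- d i, 1:]) * [:- d n, 1:] \<noteq> 0"
    by (simp only: mult_eq_0_iff prod_zero_iff finite_lessThan) simp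
  ultimately show ?case
    using Suc.IH by (simp only: prod.lessThan_Suc order_mult[OF nz] order_linear_factor add.commute)
qed (simp add: order_1_eq_0)

lemma equal_multiplicities_imp_permutes:
  assumes "\<And>z. card {i. i < n \<and> f i = z} = card {i. i < n \<and> g i = z}"
  shows "\<exists>\<rho>. \<rho> permutes {..<n::nat} \<and> (\<forall>i<n. g (\<rho> i) = f i)"
proof -
  have cnt: "count (image_mset h (mset_set {..<n})) z = card {i. i < n \<and> h i = z}" for h :: "nat \<Rightarrow> 'a" and z
    by (simp add: count_image_mset_eq_card_vimage)
  have "image_mset f (mset_set {..<n}) = image_mset g (mset_set {..<n})"
    by (rule multiset_eqI) (simp add: cnt assms)
  then obtain p where "p permutes {..<n}" "\<forall>x\<in>{..<n}. f x = g (p x)"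
    using image_mset_eq_implies_permutes[of "{..<n}" f g] by blast
  then show ?thesis by (metis lessThan_iff)
qed

text \<open>
  Algebraic multiplicities are read off the diagonal of a triangular form, so any
  listing of the spectrum is a rearrangement of that diagonal.
\<close>
lemma spectrum_of_similar_triangular:
  assumes X: "X \<in> carrier_mat n n" "similar_mat X R" "upper_triangular R"
    and ev: "lists_spectrum ev X"
  shows "\<exists>\<rho>. \<rho> permutes {..<n} \<and> (\<forall>i<n. ev (\<rho> i) = R $$ (i, i))"
proof (rule equal_multiplicities_imp_permutes)
  fix z
  have R: "R \<in> carrier_mat n n" using X(1,2) by (auto simp: similar_mat_def similar_mat_wit_def Let_def)
  have "char_poly X = (\<Prod>a\<leftarrow>diag_mat R. [:- a, 1:])"
    using char_poly_similar[OF X(2)] char_poly_upper_triangular[OF R X(3)] by simp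
  also have "\<dots> = (\<Prod>i<n. [:- R $$ (i, i), 1:])"
    using R by (simp add: diag_mat_def prod.list_conv_set_nth atLeast0LessThan)
  finally show "card {i. i < n \<and> R $$ (i, i) = z} = card {i. i < n \<and> ev i = z}"
    using ev X(1) by (simp add: lists_spectrum_def order_prod_linear_factors)
qed

lemma frobenius_norm_sq:
  "X \<in> carrier_mat n n \<Longrightarrow> (frobenius_norm X)\<^sup>2 = (\<Sum>i<n. \<Sum>j<n. (cmod (X $$ (i, j)))\<^sup>2)"
  by (auto simp: frobenius_norm_def intro!: real_sqrt_pow2 sum_nonneg)

text \<open>
  The diagonal of \<open>Y\<^sup>* Y\<close> holds the squared lengths of the columns.
  Unitary invariance of the norm and the balance of rows and columns of a normal matrix
  both come from this.
\<close>
lemma adjoint_mult_diag: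
  assumes "Y \<in> carrier_mat m n" "j < n"
  shows "(mat_adjoint Y * Y) $$ (j, j) = of_real (\<Sum>i<m. (cmod (Y $$ (i, j)))\<^sup>2)"
proof -
  have "cnj z * z = of_real ((cmod z)\<^sup>2)" for z by (metis complex_norm_square mult.commute)
  then show ?thesis
    using assms by (simp add: scalar_prod_def atLeast0LessThan del: of_real_power)
qed

lemma frobenius_norm_adjoint:
  assumes X: "X \<in> carrier_mat n n"
  shows "(frobenius_norm (mat_adjoint X))\<^sup>2 = (frobenius_norm X)\<^sup>2"
  unfolding frobenius_norm_sq[OF X] frobenius_norm_sq[OF mat_adjoint_carrier[OF X]]
  by (subst sum.swap) (use X in simp)

lemma frobenius_norm_unitary_left:
  assumes U: "unitary_mat n U" and X: "X \<in> carrier_mat n n"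
  shows "(frobenius_norm (U * X))\<^sup>2 = (frobenius_norm X)\<^sup>2"
proof -
  note u = unitary_matD[OF U]
  have "mat_adjoint (U * X) * (U * X) = mat_adjoint X * ((mat_adjoint U * U) * X)"
    using u(1) X by (simp add: mat_adjoint_mult[of _ n n _ n] assoc_mult_mat[of _ n n _ n _ n])
  then have eq: "mat_adjoint (U * X) * (U * X) = mat_adjoint X * X" using u(2) X by simp
  have UX: "U * X \<in> carrier_mat n n" using u(1) X by simp
  have "(\<Sum>i<n. (cmod ((U * X) $$ (i, j)))\<^sup>2) = (\<Sum>i<n. (cmod (X $$ (i, j)))\<^sup>2)" if "j < n" for j
    using arg_cong[OF eq, of "\<lambda>Z. Z $$ (j, j)"] adjoint_mult_diag[OF UX that] adjoint_mult_diag[OF X that]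
    by (simp only: of_real_eq_iff)
  then have "(\<Sum>j<n. \<Sum>i<n. (cmod ((U * X) $$ (i, j)))\<^sup>2) = (\<Sum>j<n. \<Sum>i<n. (cmod (X $$ (i, j)))\<^sup>2)"
    by (rule sum.cong[OF refl]) (simp only: lessThan_iff)
  then show ?thesis
    unfolding frobenius_norm_sq[OF UX] frobenius_norm_sq[OF X]
    using sum.swap[of "\<lambda>i j. (cmod ((U * X) $$ (i, j)))\<^sup>2" "{..<n}" "{..<n}"]
      sum.swap[of "\<lambda>i j. (cmod (X $$ (i, j)))\<^sup>2" "{..<n}" "{..<n}"] by linarith
qed

lemma unitary_mat_adjoint:
  assumes "unitary_mat n U"
  shows "unitary_mat n (mat_adjoint U)"
  unfolding unitary_mat_def using unitary_matD[OF assms] by simp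

lemma frobenius_norm_unitary_conj:
  assumes U: "unitary_mat n U" and X: "X \<in> carrier_mat n n"
  shows "(frobenius_norm (mat_adjoint U * X * U))\<^sup>2 = (frobenius_norm X)\<^sup>2"
proof -
  note u = unitary_matD[OF U]
  have adj: "mat_adjoint (X * U) = mat_adjoint U * mat_adjoint X"
    using u(1) X by (simp add: mat_adjoint_mult[of _ n n _ n])
  have "(frobenius_norm (mat_adjoint U * X * U))\<^sup>2 = (frobenius_norm (mat_adjoint U * (X * U)))\<^sup>2"
    using u(1) X by (simp add: assoc_mult_mat[of _ n n _ n _ n])
  also have "\<dots> = (frobenius_norm (X * U))\<^sup>2"
    using frobenius_norm_unitary_left[OF unitary_mat_adjoint[OF U]] u(1) X by simp
  also have "\<dots> = (frobenius_norm (mat_adjoint U * mat_adjoint X))\<^sup>2"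
    using frobenius_norm_adjoint[of "X * U" n] u(1) X adj by simp
  also have "\<dots> = (frobenius_norm (mat_adjoint X))\<^sup>2"
    using frobenius_norm_unitary_left[OF unitary_mat_adjoint[OF U]] u(1) X by simp
  finally show ?thesis using frobenius_norm_adjoint[OF X] by simp
qed

lemma mat_trace_mult_commute:
  fixes X Y :: "'a :: comm_semiring_0 mat"
  assumes "X \<in> carrier_mat n m" "Y \<in> carrier_mat m n"
  shows "mat_trace (X * Y) = mat_trace (Y * X)"
proof -
  have "mat_trace (X * Y) = (\<Sum>i<n. \<Sum>j<m. X $$ (i, j) * Y $$ (j, i))"
    using assms by (simp add: mat_trace_def scalar_prod_def atLeast0LessThan)
  also have "\<dots> = (\<Sum>j<m. \<Sum>i<n. Y $$ (j, i) * X $$ (i, j))"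
    by (subst sum.swap) (simp add: mult.commute)
  also have "\<dots> = mat_trace (Y * X)"
    using assms by (simp add: mat_trace_def scalar_prod_def atLeast0LessThan)
  finally show ?thesis .
qed

lemma mat_trace_conj:
  fixes P Q X :: "'a :: comm_semiring_1 mat"
  assumes "P \<in> carrier_mat n n" "Q \<in> carrier_mat n n" "X \<in> carrier_mat n n" "P * Q = 1\<^sub>m n"
  shows "mat_trace (Q * X * P) = mat_trace X"
proof -
  have "mat_trace (Q * X * P) = mat_trace (P * (Q * X))"
    using assms by (intro mat_trace_mult_commute[of _ n n]) auto
  also have "P * (Q * X) = X"
    using assms assoc_mult_mat[of P n n Q n X n] by simp
  finally show ?thesis .
qed

text \<open>
  Steiner's identity for complex numbers with mean \<open>c\<close>.
\<close>
lemma sum_centered_sq: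
  fixes x :: "nat \<Rightarrow> complex"
  assumes c: "(\<Sum>i<n. x i) = of_nat n * c"
  shows "(\<Sum>i<n. (cmod (x i - c))\<^sup>2) = (\<Sum>i<n. (cmod (x i))\<^sup>2) - real n * (cmod c)\<^sup>2"
proof -
  have "(cmod (x i - c))\<^sup>2 = (cmod (x i))\<^sup>2 - 2 * Re (cnj c * x i) + (cmod c)\<^sup>2" for i
    unfolding cmod_power2 by (simp add: power2_eq_square algebra_simps)
  then have "(\<Sum>i<n. (cmod (x i - c))\<^sup>2)
      = (\<Sum>i<n. (cmod (x i))\<^sup>2 - 2 * Re (cnj c * x i) + (cmod c)\<^sup>2)" by (simp only:)
  also have "\<dots> = (\<Sum>i<n. (cmod (x i))\<^sup>2) - 2 * Re (cnj c * (\<Sum>i<n. x i)) + real n * (cmod c)\<^sup>2"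
    by (simp only: sum.distrib sum_subtractf sum_distrib_left Re_sum sum_constant card_lessThan)
  also have "Re (cnj c * (\<Sum>i<n. x i)) = real n * (cmod c)\<^sup>2"
    unfolding c cmod_power2 by (simp add: power2_eq_square algebra_simps)
  finally show ?thesis by simp
qed

text \<open>
  The radicand of \<open>\<delta>(X)\<close> is the squared norm of \<open>X\<close>
  minus the scalar matrix with the same trace.
\<close>
lemma frobenius_norm_minus_trace:
  assumes n: "0 < n" and X: "X \<in> carrier_mat n n"
  shows "(frobenius_norm X)\<^sup>2 - (cmod (mat_trace X))\<^sup>2 / real n =
    (\<Sum>i<n. \<Sum>j<n. (cmod (X $$ (i, j) - (if i = j then mat_trace X / of_nat n else 0)))\<^sup>2)" (is "?R = ?S")
proof -
  let ?c = "mat_trace X / of_nat n"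
  have pt: "(cmod (X $$ (i, j) - (if i = j then ?c else 0)))\<^sup>2 = (cmod (X $$ (i, j)))\<^sup>2
      + (if i = j then (cmod (X $$ (i, i) - ?c))\<^sup>2 - (cmod (X $$ (i, i)))\<^sup>2 else 0)" for i j
    by simp
  have "?S = (frobenius_norm X)\<^sup>2 + (\<Sum>i<n. (cmod (X $$ (i, i) - ?c))\<^sup>2 - (cmod (X $$ (i, i)))\<^sup>2)"
    unfolding pt by (simp add: sum.distrib frobenius_norm_sq[OF X])
  also have "(\<Sum>i<n. (cmod (X $$ (i, i) - ?c))\<^sup>2 - (cmod (X $$ (i, i)))\<^sup>2) = - (real n * (cmod ?c)\<^sup>2)"
    using sum_centered_sq[where x = "\<lambda>i. X $$ (i, i)" and c = ?c and n = n] n X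
    by (simp add: sum_subtractf mat_trace_def)
  also have "real n * (cmod ?c)\<^sup>2 = (cmod (mat_trace X))\<^sup>2 / real n"
    using n by (simp add: norm_divide power_divide power2_eq_square)
  finally show ?thesis by simp
qed

lemma mat_delta_nonneg:
  assumes "0 < n" "X \<in> carrier_mat n n"
  shows "0 \<le> mat_delta X"
  using frobenius_norm_minus_trace[OF assms] assms by (simp add: mat_delta_def sum_nonneg)

lemma mat_delta_sq:
  assumes n: "0 < n" and X: "X \<in> carrier_mat n n"
  shows "(mat_delta X)\<^sup>2 =
    (\<Sum>i<n. \<Sum>j<n. (cmod (X $$ (i, j) - (if i = j then mat_trace X / of_nat n else 0)))\<^sup>2)"
proof -
  have "(mat_delta X)\<^sup>2 = (frobenius_norm X)\<^sup>2 - (cmod (mat_trace X))\<^sup>2 / real n"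
    using frobenius_norm_minus_trace[OF assms] X
    by (auto simp: mat_delta_def intro!: real_sqrt_pow2 sum_nonneg)
  then show ?thesis using frobenius_norm_minus_trace[OF assms] by simp
qed


section \<open>Perturbation of a diagonal matrix\<close>

text \<open>
  Weighting the balance of row \<open>i\<close> and column \<open>i\<close> by
  \<open>i\<close> and adding up gives \<open>\<Sum>\<^sub>i\<^sub>j (i - j) g i j =
  0\<close>. Each entry above the diagonal enters with coefficient at most
  \<open>-1\<close>, each entry below it with coefficient at most \<open>n - 1\<close>.
\<close>
lemma balanced_upper_le_lower:
  fixes g :: "nat \<Rightarrow> nat \<Rightarrow> real"
  assumes nn: "\<And>i j. 0 \<le> g i j"
    and bal: "\<And>i. i < n \<Longrightarrow> (\<Sum>j<n. g i j) = (\<Sum>j<n. g j i)"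
  shows "(\<Sum>i<n. \<Sum>j<n. if i < j then g i j else 0)
    \<le> (real n - 1) * (\<Sum>i<n. \<Sum>j<n. if j < i then g i j else 0)"
proof -
  have "(\<Sum>i<n. \<Sum>j<n. real i * g i j) = (\<Sum>i<n. \<Sum>j<n. real i * g j i)"
    using bal by (simp add: sum_distrib_left[symmetric])
  also have "\<dots> = (\<Sum>i<n. \<Sum>j<n. real j * g i j)" by (rule sum.swap)
  finally have "(\<Sum>i<n. \<Sum>j<n. (real i - real j) * g i j) = 0"
    by (simp add: left_diff_distrib sum_subtractf)
  then have "(\<Sum>i<n. \<Sum>j<n. if i < j then g i j else 0)
      = (\<Sum>i<n. \<Sum>j<n. (if i < j then g i j else 0) + (real i - real j) * g i j)"
    by (simp only: sum.distrib)
  also have "\<dots> \<le> (\<Sum>i<n. \<Sum>j<n. (real n - 1) * (if j < i then g i j else 0))"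
  proof (intro sum_mono)
    fix i j assume "i \<in> {..<n}" "j \<in> {..<n}"
    then have ij: "i < n" "j < n" by auto
    show "(if i < j then g i j else 0) + (real i - real j) * g i j
      \<le> (real n - 1) * (if j < i then g i j else 0)"
    proof (cases i j rule: linorder_cases)
      case less
      then have "(1 + real i - real j) * g i j \<le> 0" using nn by (intro mult_nonpos_nonneg) auto
      then show ?thesis using less by (simp add: algebra_simps)
    next
      case greater
      then have "(real i - real j) * g i j \<le> (real n - 1) * g i j"
        using nn ij by (intro mult_right_mono) auto
      then show ?thesis using greater by simp
    qed simp
  qed
  also have "\<dots> = (real n - 1) * (\<Sum>i<n. \<Sum>j<n. if j < i then g i j else 0)"
    by (simp only: sum_distrib_left)
  finally show ?thesis .
qed

text \<open>
  In a normal matrix the \<open>i\<close>-th row and the \<open>i\<close>-th column have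
  the same length.
\<close>
lemma normal_upper_le_lower:
  assumes N: "N \<in> carrier_mat n n" and normal: "mat_adjoint N * N = N * mat_adjoint N"
  shows "(\<Sum>i<n. \<Sum>j<n. if i < j then (cmod (N $$ (i, j)))\<^sup>2 else 0)
    \<le> (real n - 1) * (\<Sum>i<n. \<Sum>j<n. if j < i then (cmod (N $$ (i, j)))\<^sup>2 else 0)"
proof (rule balanced_upper_le_lower)
  fix i assume i: "i < n"
  have "complex_of_real (\<Sum>j<n. (cmod (N $$ (j, i)))\<^sup>2) = of_real (\<Sum>j<n. (cmod (mat_adjoint N $$ (j, i)))\<^sup>2)"
    using adjoint_mult_diag[OF N i] adjoint_mult_diag[of "mat_adjoint N" n n i] N i normal by simp
  then show "(\<Sum>j<n. (cmod (N $$ (i, j)))\<^sup>2) = (\<Sum>j<n. (cmod (N $$ (j, i)))\<^sup>2)"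
    unfolding of_real_eq_iff using N i by simp
qed simp

lemma unitary_moduli_doubly_stochastic:
  assumes U: "unitary_mat n U"
  shows "i < n \<Longrightarrow> (\<Sum>j<n. (cmod (U $$ (i, j)))\<^sup>2) = 1" "j < n \<Longrightarrow> (\<Sum>i<n. (cmod (U $$ (i, j)))\<^sup>2) = 1"
proof -
  have col: "(\<Sum>i<n. (cmod (V $$ (i, j)))\<^sup>2) = 1" if V: "unitary_mat n V" and j: "j < n" for V j
  proof -
    have "complex_of_real (\<Sum>i<n. (cmod (V $$ (i, j)))\<^sup>2) = of_real 1"
      using adjoint_mult_diag[OF unitary_matD(1)[OF V] j] unitary_matD(2)[OF V] j by simp
    then show ?thesis unfolding of_real_eq_iff .
  qed
  show "(\<Sum>i<n. (cmod (U $$ (i, j)))\<^sup>2) = 1" if "j < n" using col[OF U that] .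
  show "(\<Sum>j<n. (cmod (U $$ (i, j)))\<^sup>2) = 1" if "i < n"
    using col[OF unitary_mat_adjoint[OF U] that] unitary_matD(1)[OF U] that by simp
qed

text \<open>
  In the notation of the introduction, with \<open>G = U\<^sup>* F U\<close>: the matrix
  \<open>N - (D - c)\<close> agrees up to sign with \<open>G - c\<close> on and below
  the diagonal and with \<open>N\<close> above it. Its norm is bounded through the
  normality of \<open>N\<close> and computed as a sum of costs with doubly stochastic
  weights.
\<close>
theorem diagonal_perturbation_spectrum:
  assumes n: "0 < n" and F: "F \<in> carrier_mat n n"
    and ev: "lists_spectrum ev (mat_diag n l + F)"
  shows "\<exists>\<pi>. \<pi> permutes {..<n} \<and> (\<Sum>i<n. (cmod (ev (\<pi> i) - l i))\<^sup>2)
    \<le> real n * (mat_delta F)\<^sup>2 + (cmod (mat_trace F))\<^sup>2 / real n"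
proof -
  let ?L = "mat_diag n l"
  have L: "?L \<in> carrier_mat n n" by simp
  have M: "?L + F \<in> carrier_mat n n" using F by simp
  obtain U R where U: "unitary_mat n U" and R: "R \<in> carrier_mat n n" "upper_triangular R"
    and MR: "?L + F = U * R * mat_adjoint U" using unitary_schur[OF M] by blast
  note u = unitary_matD[OF U]
  let ?V = "mat_adjoint U"
  have V: "?V \<in> carrier_mat n n" using u(1) by simp
  define N where "N = ?V * ?L * U"
  define G where "G = ?V * F * U"
  have N: "N \<in> carrier_mat n n" and G: "G \<in> carrier_mat n n"
    using u(1) V L F by (auto simp: N_def G_def)
  have cancel: "U * (?V * X) = X" "?V * (U * X) = X" if "X \<in> carrier_mat n n" for X
    using assoc_mult_mat[OF u(1) V that] assoc_mult_mat[OF V u(1) that] u(2,3) that by simp_all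
  note sq = mult_carrier_mat[of _ n n _ n] assoc_mult_mat[of _ n n _ n _ n]
  have RNG: "R = N + G"
  proof -
    have "N + G = ?V * ((?L + F) * U)"
      using u(1) V L F
      by (simp add: N_def G_def sq mult_add_distrib_mat[of _ n n _ n] add_mult_distrib_mat[of _ n n _ _ n])
    also have "\<dots> = R" using u V R(1) unfolding MR by (simp add: sq cancel)
    finally show ?thesis ..
  qed
  define c where "c = mat_trace F / of_nat n"
  have trG: "mat_trace G = mat_trace F"
    unfolding G_def by (rule mat_trace_conj[OF u(1) V F u(3)])
  have trN: "mat_trace N = (\<Sum>i<n. l i)"
    unfolding N_def mat_trace_conj[OF u(1) V L u(3)] by (simp add: mat_trace_def mat_diag_def)
  have deltaG: "(mat_delta G)\<^sup>2 = (mat_delta F)\<^sup>2"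
  proof -
    have "(frobenius_norm G)\<^sup>2 = (frobenius_norm F)\<^sup>2"
      unfolding G_def by (rule frobenius_norm_unitary_conj[OF U F])
    then show ?thesis using trG F G by (simp add: mat_delta_def)
  qed
  have adjL: "mat_adjoint ?L = mat_diag n (\<lambda>i. cnj (l i))"
    by (intro eq_matI) (auto simp: mat_diag_def)
  have normal: "mat_adjoint N * N = N * mat_adjoint N"
  proof -
    have adjN: "mat_adjoint N = ?V * mat_adjoint ?L * U"
      using u(1) V L by (simp add: N_def mat_adjoint_mult[of _ n n _ n] sq)
    have "mat_adjoint N * N = ?V * ((mat_adjoint ?L * ?L) * U)"
      unfolding adjN unfolding N_def using u(1) V L by (simp add: sq cancel del: mat_diag_diag)
    moreover have "N * mat_adjoint N = ?V * ((?L * mat_adjoint ?L) * U)"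
      unfolding adjN unfolding N_def using u(1) V L by (simp add: sq cancel del: mat_diag_diag)
    moreover have "mat_adjoint ?L * ?L = ?L * mat_adjoint ?L"
      unfolding adjL by (simp add: mult.commute)
    ultimately show ?thesis by simp
  qed
  define d where "d i = R $$ (i, i)" for i
  let ?D = "mat_diag n (\<lambda>i. d i - c)"
  define k where "k i j = (cmod (G $$ (i, j) - (if i = j then c else 0)))\<^sup>2" for i j
  have deltak: "(\<Sum>i<n. \<Sum>j<n. k i j) = (mat_delta F)\<^sup>2"
    unfolding k_def c_def trG[symmetric] deltaG[symmetric] by (rule mat_delta_sq[OF n G, symmetric])
  have entries: "(cmod ((N - ?D) $$ (i, j)))\<^sup>2
      = (if i < j then (cmod (N $$ (i, j)))\<^sup>2 else k i j)" if "i < n" "j < n" for i j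
  proof -
    have Rij: "R $$ (i, j) = N $$ (i, j) + G $$ (i, j)" using RNG N G that by simp
    have ND: "(N - ?D) $$ (i, j) = N $$ (i, j) - (if i = j then d j - c else 0)"
      using N that by (simp add: mat_diag_def)
    show ?thesis
    proof (cases i j rule: linorder_cases)
      case equal
      then have "(N - ?D) $$ (i, j) = - (G $$ (i, j) - c)" using ND Rij by (simp add: d_def)
      then show ?thesis using equal by (simp only: norm_minus_cancel) (simp add: k_def)
    next
      case greater
      then have "R $$ (i, j) = 0" using R that by auto
      then have "N $$ (i, j) = - G $$ (i, j)" using Rij by (simp add: eq_neg_iff_add_eq_0)
      then show ?thesis using greater ND by (simp add: k_def)
    qed (use ND in simp)
  qed
  \<comment> \<open>below the diagonal \<open>R = N + G\<close> vanishes, so that \<open>N\<close> is as small as \<open>G\<close> there\<close>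
  have lowerN: "(if j < i then (cmod (N $$ (i, j)))\<^sup>2 else 0) \<le> k i j" if "i < n" "j < n" for i j
  proof (cases "j < i")
    case True
    then have "R $$ (i, j) = 0" using R that by auto
    then have "N $$ (i, j) = - G $$ (i, j)" using RNG N G that by (simp add: eq_neg_iff_add_eq_0)
    then show ?thesis using True by (simp add: k_def)
  qed (simp add: k_def)
  have normND: "(frobenius_norm (N - ?D))\<^sup>2 \<le> real n * (mat_delta F)\<^sup>2"
  proof -
    have "(frobenius_norm (N - ?D))\<^sup>2 = (\<Sum>i<n. \<Sum>j<n. (cmod ((N - ?D) $$ (i, j)))\<^sup>2)"
      by (intro frobenius_norm_sq minus_carrier_mat mat_diag_dim)
    also have "\<dots> = (\<Sum>i<n. \<Sum>j<n. if i < j then (cmod (N $$ (i, j)))\<^sup>2 else k i j)"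
      by (intro sum.cong refl entries) auto
    also have "\<dots> \<le> (\<Sum>i<n. \<Sum>j<n. (if i < j then (cmod (N $$ (i, j)))\<^sup>2 else 0) + k i j)"
      by (intro sum_mono) (simp add: k_def)
    also have "\<dots> = (\<Sum>i<n. \<Sum>j<n. if i < j then (cmod (N $$ (i, j)))\<^sup>2 else 0) + (mat_delta F)\<^sup>2"
      by (simp only: sum.distrib deltak)
    also have "\<dots> \<le> (real n - 1) * (\<Sum>i<n. \<Sum>j<n. if j < i then (cmod (N $$ (i, j)))\<^sup>2 else 0) + (mat_delta F)\<^sup>2"
      using normal_upper_le_lower[OF N normal] by (rule add_right_mono)
    also have "\<dots> \<le> (real n - 1) * (\<Sum>i<n. \<Sum>j<n. k i j) + (mat_delta F)\<^sup>2"
      using n by (intro add_right_mono mult_left_mono sum_mono lowerN) auto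
    also have "\<dots> = real n * (mat_delta F)\<^sup>2" by (simp add: deltak algebra_simps)
    finally show ?thesis .
  qed
  \<comment> \<open>multiplying by \<open>U\<close> leaves the norm unchanged and turns \<open>N - D + c\<close> into \<open>\<Lambda> U - U (D - c)\<close>\<close>
  have UND: "(frobenius_norm (N - ?D))\<^sup>2 = (\<Sum>i<n. \<Sum>j<n. (cmod (U $$ (i, j)))\<^sup>2 * (cmod (d j - c - l i))\<^sup>2)"
  proof -
    have ND: "N - ?D \<in> carrier_mat n n" by (intro minus_carrier_mat mat_diag_dim)
    have "U * (N - ?D) = ?L * U - U * ?D"
      using u(1) V L N by (simp add: mult_minus_distrib_mat[of _ n n _ n] N_def sq cancel)
    also have "\<dots> = mat n n (\<lambda>(i, j). U $$ (i, j) * (l i - (d j - c)))"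
      using u(1) by (intro eq_matI) (auto simp: mat_diag_mult_left[of _ n n] mat_diag_mult_right[of _ n n] algebra_simps)
    finally have "(frobenius_norm (N - ?D))\<^sup>2 = (frobenius_norm (mat n n (\<lambda>(i, j). U $$ (i, j) * (l i - (d j - c)))))\<^sup>2"
      using frobenius_norm_unitary_left[OF U ND] by simp
    then show ?thesis
      by (simp add: frobenius_norm_sq[of _ n] norm_mult power_mult_distrib norm_minus_commute)
  qed
  obtain \<sigma> where \<sigma>: "\<sigma> permutes {..<n}"
    and le: "1 * (\<Sum>i<n. (cmod (d (\<sigma> i) - c - l i))\<^sup>2)
      \<le> (\<Sum>i<n. \<Sum>j<n. (cmod (U $$ (i, j)))\<^sup>2 * (cmod (d j - c - l i))\<^sup>2)"
    using optimal_assignment_le_doubly_stochastic[of n "\<lambda>i j. (cmod (U $$ (i, j)))\<^sup>2" 1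
        "\<lambda>i j. (cmod (d j - c - l i))\<^sup>2"] unitary_moduli_doubly_stochastic[OF U] by auto
  \<comment> \<open>undo the centring: the differences \<open>d (\<sigma> i) - l i\<close> have mean \<open>c\<close>\<close>
  have "(\<Sum>i<n. d (\<sigma> i)) = (\<Sum>i<n. d i)" using sum.permute[OF \<sigma>, of d] by (simp add: comp_def)
  also have "\<dots> = (\<Sum>i<n. l i) + mat_trace F"
    using RNG N G trN trG by (simp add: d_def mat_trace_def sum.distrib)
  finally have "(\<Sum>i<n. d (\<sigma> i) - l i) = of_nat n * c" using n by (simp add: sum_subtractf c_def)
  from sum_centered_sq[OF this]
  have "(\<Sum>i<n. (cmod (d (\<sigma> i) - l i))\<^sup>2) = (\<Sum>i<n. (cmod (d (\<sigma> i) - c - l i))\<^sup>2) + real n * (cmod c)\<^sup>2"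
    by (simp add: algebra_simps)
  also have "\<dots> \<le> real n * (mat_delta F)\<^sup>2 + (cmod (mat_trace F))\<^sup>2 / real n"
    using le UND normND n by (simp add: c_def norm_divide power_divide power2_eq_square)
  finally have bound: "(\<Sum>i<n. (cmod (d (\<sigma> i) - l i))\<^sup>2)
    \<le> real n * (mat_delta F)\<^sup>2 + (cmod (mat_trace F))\<^sup>2 / real n" .
  have "similar_mat (?L + F) R"
    using similar_mat_witI[OF u(3) u(2) MR M R(1) u(1) V] by (auto simp: similar_mat_def)
  from spectrum_of_similar_triangular[OF M this R(2) ev]
  obtain \<rho> where \<rho>: "\<rho> permutes {..<n}" "\<And>i. i < n \<Longrightarrow> ev (\<rho> i) = d i" by (auto simp: d_def)
  have "\<rho> \<circ> \<sigma> permutes {..<n}" by (rule permutes_compose[OF \<sigma> \<rho>(1)])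
  moreover have "(\<Sum>i<n. (cmod (ev ((\<rho> \<circ> \<sigma>) i) - l i))\<^sup>2) = (\<Sum>i<n. (cmod (d (\<sigma> i) - l i))\<^sup>2)"
    using \<rho>(2) permutes_in_image[OF \<sigma>] by (intro sum.cong) auto
  ultimately show ?thesis using bound by metis
qed

section \<open>Scaling the superdiagonal of a Jordan matrix\<close>

definition offdiag_sq :: "complex mat \<Rightarrow> nat \<Rightarrow> nat \<Rightarrow> real" where
  "offdiag_sq J i j = (if i = j then 0 else (cmod (J $$ (i, j)))\<^sup>2)"

lemma sum_lessThan_add:
  fixes f :: "nat \<Rightarrow> 'a :: comm_monoid_add"
  shows "(\<Sum>i<k + m. f i) = (\<Sum>i<k. f i) + (\<Sum>i<m. f (k + i))"
  by (induction m) (simp_all add: add.assoc)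

text \<open>
  A block of size \<open>k\<close> has \<open>k - 1\<close> ones above its diagonal;
  summed over all \<open>p\<close> blocks this is the number \<open>n - p\<close> in the
  theorem.
\<close>
lemma offdiag_sq_jordan_block:
  assumes "1 \<le> k"
  shows "(\<Sum>i<k. \<Sum>j<k. offdiag_sq (jordan_block k a) i j) = real k - 1"
proof -
  obtain q where q: "k = Suc q" using assms by (cases k) auto
  have "(\<Sum>i<k. \<Sum>j<k. offdiag_sq (jordan_block k a) i j) = (\<Sum>i<k. \<Sum>j<k. if Suc i = j then 1 else 0)"
    by (intro sum.cong refl) (auto simp: offdiag_sq_def)
  also have "\<dots> = (\<Sum>i<k. if Suc i < k then 1 else 0)" by (intro sum.cong refl) simp
  also have "\<dots> = real k - 1" by (simp add: q)
  finally show ?thesis .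
qed

text \<open>
  The grading \<open>s i\<close> is the position of row \<open>i\<close> within its
  block. It stays below the block size, which bounds the scaling factors; the
  off-diagonal ones raise it by exactly one, so scaling turns each of them into
  \<open>e\<close>; and their number enters the bound.
\<close>
lemma jordan_matrix_grading:
  assumes "\<forall>(k, a) \<in> set bs. 1 \<le> k"
  defines "n \<equiv> sum_list (map fst bs)" and "J \<equiv> jordan_matrix bs"
  shows "\<exists>s. (\<forall>i<n. \<exists>(k, a) \<in> set bs. s i < k)
    \<and> (\<forall>i<n. \<forall>j<n. i \<noteq> j \<longrightarrow> J $$ (i, j) = 0 \<or> J $$ (i, j) = 1 \<and> s j = Suc (s i))
    \<and> (\<Sum>i<n. \<Sum>j<n. offdiag_sq J i j) = real n - real (length bs)"
  using assms(1) unfolding n_def J_def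
proof (induction bs)
  case (Cons b bs)
  obtain k a where b: "b = (k, a)" by (cases b)
  let ?m = "sum_list (map fst bs)" and ?K = "jordan_matrix bs"
  let ?J = "jordan_matrix (b # bs)"
  have "\<forall>(k, a) \<in> set bs. 1 \<le> k" using Cons.prems by simp
  from Cons.IH[OF this] obtain s where s: "\<And>i. i < ?m \<Longrightarrow> \<exists>(k, a) \<in> set bs. s i < k"
    and ent: "\<And>i j. i < ?m \<Longrightarrow> j < ?m \<Longrightarrow> i \<noteq> j \<Longrightarrow> ?K $$ (i, j) = 0 \<or> ?K $$ (i, j) = 1 \<and> s j = Suc (s i)"
    and sm: "(\<Sum>i<?m. \<Sum>j<?m. offdiag_sq ?K i j) = real ?m - real (length bs)"
    by blast
  have k: "1 \<le> k" using Cons.prems b by auto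
  define s' where "s' i = (if i < k then i else s (i - k))" for i
  have J: "?J $$ (i, j) = (if i < k then if j < k then jordan_block k a $$ (i, j) else 0
      else if j < k then 0 else ?K $$ (i - k, j - k))" if "i < k + ?m" "j < k + ?m" for i j
    using that unfolding b jordan_matrix_Cons by auto
  have "\<exists>(k, a) \<in> set (b # bs). s' i < k" if "i < k + ?m" for i
  proof (cases "i < k")
    case True
    then show ?thesis by (auto simp: b s'_def)
  next
    case False
    then have "i - k < ?m" using that by auto
    from s[OF this] show ?thesis using False by (auto simp: s'_def)
  qed
  moreover have "?J $$ (i, j) = 0 \<or> ?J $$ (i, j) = 1 \<and> s' j = Suc (s' i)"
    if ij: "i < k + ?m" "j < k + ?m" "i \<noteq> j" for i j
  proof (cases "i < k \<or> j < k")
    case True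
    then show ?thesis using ij J[OF ij(1,2)] by (auto simp: s'_def)
  next
    case False
    then have "i - k < ?m" "j - k < ?m" "i - k \<noteq> j - k" using ij by auto
    from ent[OF this] show ?thesis using False J[OF ij(1,2)] by (auto simp: s'_def)
  qed
  moreover have "(\<Sum>i<k + ?m. \<Sum>j<k + ?m. offdiag_sq ?J i j) = real (k + ?m) - real (length (b # bs))"
  proof -
    have entries: "offdiag_sq ?J i j = offdiag_sq (jordan_block k a) i j" if "i < k" "j < k" for i j
      using that by (simp add: offdiag_sq_def J)
    have zeros: "offdiag_sq ?J i (k + j) = 0" "offdiag_sq ?J (k + j) i = 0" if "i < k" "j < ?m" for i j
      using that by (simp_all add: offdiag_sq_def J)
    have rest: "offdiag_sq ?J (k + i) (k + j) = offdiag_sq ?K i j" if "i < ?m" "j < ?m" for i j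
      using that by (simp add: offdiag_sq_def J)
    have "(\<Sum>i<k. \<Sum>j<k + ?m. offdiag_sq ?J i j) = (\<Sum>i<k. \<Sum>j<k. offdiag_sq (jordan_block k a) i j)"
      by (simp add: sum_lessThan_add entries zeros)
    moreover have "(\<Sum>i<?m. \<Sum>j<k + ?m. offdiag_sq ?J (k + i) j) = (\<Sum>i<?m. \<Sum>j<?m. offdiag_sq ?K i j)"
      by (simp add: sum_lessThan_add zeros rest)
    ultimately show ?thesis
      unfolding sum_lessThan_add[of _ k ?m]
      using sm offdiag_sq_jordan_block[OF k, of a] by (simp only: sum_lessThan_add) simp
  qed
  ultimately show ?case
    unfolding b by (intro exI[of _ s'] conjI allI impI) (simp_all only: b list.map sum_list.Cons fst_conv)
qed simp

text \<open>
  The scaling factor of the entry \<open>(i, j)\<close> is \<open>e\<close> raised to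
  \<open>s j - s i\<close>. It is \<open>1\<close> on the diagonal, so the trace
  survives; it is \<open>e\<close> where \<open>J\<close> has a one; elsewhere it is at
  most \<open>e / e\<^sup>m\<close>, as \<open>s j - s i \<ge> 1 - m\<close>. The bound
  is proved entrywise, apart from the mixed term \<open>h k\<close>, where
  \<open>h\<close> marks the ones of \<open>J\<close> and \<open>k\<close> holds the
  moduli of the centred \<open>K\<close>; that term is summed by Cauchy--Schwarz.
\<close>
lemma delta_sq_scaled_le:
  assumes n: "0 < n" and K: "K \<in> carrier_mat n n"
    and s: "\<And>i. i < n \<Longrightarrow> s i < m"
    and J: "\<And>i j. i < n \<Longrightarrow> j < n \<Longrightarrow> i \<noteq> j \<Longrightarrow> J $$ (i, j) = 0 \<or> J $$ (i, j) = 1 \<and> s j = Suc (s i)"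
    and q: "(\<Sum>i<n. \<Sum>j<n. offdiag_sq J i j) = q"
    and e: "0 < e" "e \<le> 1"
  defines "F \<equiv> mat n n (\<lambda>(i, j). of_real (e ^ s j / e ^ s i) * ((if i = j then 0 else J $$ (i, j)) + K $$ (i, j)))"
  shows "mat_trace F = mat_trace K"
    and "(mat_delta F)\<^sup>2 \<le> e\<^sup>2 * (q + 2 * sqrt q * mat_delta K + (mat_delta K)\<^sup>2 / (e ^ m)\<^sup>2)"
proof -
  have F: "F \<in> carrier_mat n n" by (simp add: F_def)
  show tr: "mat_trace F = mat_trace K" using K e by (simp add: mat_trace_def F_def)
  define c where "c = mat_trace K / of_nat n"
  define k where "k i j = cmod (K $$ (i, j) - (if i = j then c else 0))" for i j
  define h where "h = offdiag_sq J"
  have m: "1 \<le> m" using s[OF n] by simp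
  have em: "0 < e ^ m" "e ^ m \<le> e" "e ^ m \<le> 1"
    using e m power_decreasing[of 1 m e] by (auto simp: power_le_one)
  have deltaK: "(mat_delta K)\<^sup>2 = (\<Sum>i<n. \<Sum>j<n. (k i j)\<^sup>2)"
    unfolding mat_delta_sq[OF n K] k_def c_def ..
  have deltaF: "(mat_delta F)\<^sup>2 = (\<Sum>i<n. \<Sum>j<n. (cmod (F $$ (i, j) - (if i = j then c else 0)))\<^sup>2)"
    unfolding mat_delta_sq[OF n F] tr c_def ..
  have one_le: "1 \<le> 1 / e ^ m" using em by simp
  have pt: "(cmod (F $$ (i, j) - (if i = j then c else 0)))\<^sup>2
      \<le> e\<^sup>2 * (h i j + 2 * (h i j * k i j) + (k i j)\<^sup>2 / (e ^ m)\<^sup>2)" if ij: "i < n" "j < n" for i j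
  proof -
    have k0: "0 \<le> k i j" by (simp add: k_def)
    consider "i = j" | "i \<noteq> j" "J $$ (i, j) = 0" | "i \<noteq> j" "J $$ (i, j) = 1" "s j = Suc (s i)"
      using J[OF ij] by blast
    then show ?thesis
    proof cases
      case 1
      have "1 \<le> e / e ^ m" using em by simp
      then have "1 * k i j \<le> (e / e ^ m) * k i j" using k0 by (rule mult_right_mono)
      then have "(k i j)\<^sup>2 \<le> ((e / e ^ m) * k i j)\<^sup>2" using k0 by (intro power_mono) auto
      then show ?thesis
        using 1 ij e by (simp add: F_def k_def h_def offdiag_sq_def power_mult_distrib power_divide)
    next
      case 2
      have "e ^ s j / e ^ s i \<le> 1 / e ^ (m - 1)"
        using e s[OF ij(1)] by (intro frac_le power_le_one power_decreasing) auto
      also have "\<dots> = e / e ^ m" using e m by (cases m) auto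
      finally have "(e ^ s j / e ^ s i) * k i j \<le> (e / e ^ m) * k i j" using k0 by (rule mult_right_mono)
      then have "((e ^ s j / e ^ s i) * k i j)\<^sup>2 \<le> ((e / e ^ m) * k i j)\<^sup>2"
        using k0 e by (intro power_mono) auto
      moreover have "cmod (F $$ (i, j)) = (e ^ s j / e ^ s i) * k i j"
        using 2 ij e by (simp add: F_def k_def norm_mult norm_divide norm_power)
      ultimately show ?thesis
        using 2 by (simp add: h_def offdiag_sq_def power_mult_distrib power_divide)
    next
      case 3
      have "cmod (F $$ (i, j)) = e * cmod (1 + K $$ (i, j))"
        using 3 ij e by (simp add: F_def norm_mult)
      also have "\<dots> \<le> e * (1 + k i j)"
        using e 3 norm_triangle_ineq[of 1 "K $$ (i, j)"] by (intro mult_left_mono) (auto simp: k_def)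
      finally have "(cmod (F $$ (i, j)))\<^sup>2 \<le> (e * (1 + k i j))\<^sup>2" by (intro power_mono) auto
      also have "\<dots> = e\<^sup>2 * (1 + 2 * k i j + (k i j)\<^sup>2)"
        by (simp add: power2_eq_square algebra_simps)
      also have "(k i j)\<^sup>2 \<le> (k i j / e ^ m)\<^sup>2"
        using mult_left_mono[OF one_le k0] k0 by (intro power_mono) auto
      finally show ?thesis
        using 3 e by (simp add: h_def offdiag_sq_def power_divide)
    qed
  qed
  have cs: "(\<Sum>i<n. \<Sum>j<n. h i j * k i j) \<le> sqrt q * mat_delta K"
  proof -
    have h01: "h i j = 0 \<or> h i j = 1" if "i < n" "j < n" for i j
      using J[OF that] by (auto simp: h_def offdiag_sq_def)
    have "(\<Sum>i<n. \<Sum>j<n. h i j * k i j) = (\<Sum>(i, j)\<in>{..<n} \<times> {..<n}. \<bar>h i j\<bar> * \<bar>k i j\<bar>)"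
      by (simp add: sum.cartesian_product[symmetric] h_def offdiag_sq_def k_def)
    also have "\<dots> \<le> L2_set (\<lambda>(i, j). h i j) ({..<n} \<times> {..<n}) * L2_set (\<lambda>(i, j). k i j) ({..<n} \<times> {..<n})"
      using L2_set_mult_ineq[of "\<lambda>(i, j). h i j" "\<lambda>(i, j). k i j" "{..<n} \<times> {..<n}"]
      by (simp add: case_prod_beta)
    also have "L2_set (\<lambda>(i, j). h i j) ({..<n} \<times> {..<n}) = sqrt (\<Sum>i<n. \<Sum>j<n. (h i j)\<^sup>2)"
      by (simp add: L2_set_def sum.cartesian_product case_prod_beta)
    also have "(\<Sum>i<n. \<Sum>j<n. (h i j)\<^sup>2) = q"
      unfolding q[symmetric] h_def[symmetric]
      by (intro sum.cong refl) (use h01 in fastforce)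
    also have "L2_set (\<lambda>(i, j). k i j) ({..<n} \<times> {..<n}) = sqrt (\<Sum>i<n. \<Sum>j<n. (k i j)\<^sup>2)"
      by (simp add: L2_set_def sum.cartesian_product case_prod_beta)
    also have "\<dots> = \<bar>mat_delta K\<bar>" unfolding deltaK[symmetric] by simp
    also have "\<dots> = mat_delta K" using mat_delta_nonneg[OF n K] by simp
    finally show ?thesis .
  qed
  have "(mat_delta F)\<^sup>2 \<le> (\<Sum>i<n. \<Sum>j<n. e\<^sup>2 * (h i j + 2 * (h i j * k i j) + (k i j)\<^sup>2 / (e ^ m)\<^sup>2))"
    unfolding deltaF by (intro sum_mono pt) auto
  also have "\<dots> = e\<^sup>2 * (q + 2 * (\<Sum>i<n. \<Sum>j<n. h i j * k i j) + (mat_delta K)\<^sup>2 / (e ^ m)\<^sup>2)"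
    unfolding deltaK q[symmetric] h_def[symmetric]
    by (simp only: sum_distrib_left[symmetric] sum.distrib sum_divide_distrib[symmetric])
  also have "\<dots> \<le> e\<^sup>2 * (q + 2 * (sqrt q * mat_delta K) + (mat_delta K)\<^sup>2 / (e ^ m)\<^sup>2)"
    using cs by (intro mult_left_mono add_right_mono add_left_mono) auto
  finally show "(mat_delta F)\<^sup>2 \<le> e\<^sup>2 * (q + 2 * sqrt q * mat_delta K + (mat_delta K)\<^sup>2 / (e ^ m)\<^sup>2)"
    by (simp only: mult.assoc)
qed

section \<open>Perturbation of a matrix in Jordan form\<close>

lemma similar_mat_diag_scaling:
  fixes X :: "'a :: field mat"
  assumes X: "X \<in> carrier_mat n n" and t: "\<And>i. i < n \<Longrightarrow> t i \<noteq> 0"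
  shows "similar_mat X (mat n n (\<lambda>(i, j). t j / t i * X $$ (i, j)))" (is "similar_mat X ?Y")
proof -
  let ?T = "mat_diag n t" and ?S = "mat_diag n (\<lambda>i. 1 / t i)"
  have "mat_diag n (\<lambda>i. t i * (1 / t i)) = 1\<^sub>m n" "mat_diag n (\<lambda>i. 1 / t i * t i) = 1\<^sub>m n"
    using t by (auto simp: mat_diag_def intro!: eq_matI)
  then have TS: "?T * ?S = 1\<^sub>m n" "?S * ?T = 1\<^sub>m n" by simp_all
  have eq: "X = ?T * ?Y * ?S"
    using X t by (intro eq_matI) (auto simp: mat_diag_mult_left[of _ n n] mat_diag_mult_right[of _ n n])
  have "similar_mat_wit X ?Y ?T ?S"
    by (rule similar_mat_witI[OF TS eq X]) auto
  then show ?thesis by (auto simp: similar_mat_def)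
qed

lemma lists_spectrum_similar:
  assumes "similar_mat X Y" "lists_spectrum ev X"
  shows "lists_spectrum ev Y"
proof -
  obtain n where "X \<in> carrier_mat n n" "Y \<in> carrier_mat n n"
    using similar_matD[OF assms(1)] by (metis insert_subset)
  then have "dim_row X = dim_row Y" by simp
  then show ?thesis using assms(2) char_poly_similar[OF assms(1)] by (simp add: lists_spectrum_def)
qed

text \<open>
  A matching of \<open>ev'\<close> with the diagonal of a triangular form of
  \<open>A\<close> can be carried over to any other listing of the spectrum of
  \<open>A\<close>.
\<close>
lemma spectral_matching:
  assumes A: "A \<in> carrier_mat n n" "similar_mat A R" "upper_triangular R" "lists_spectrum ev A"
    and \<tau>: "\<tau> permutes {..<n}" "(\<Sum>i<n. (cmod (ev' (\<tau> i) - R $$ (i, i)))\<^sup>2) \<le> B"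
  shows "\<exists>\<pi>. \<pi> permutes {..<n} \<and> (\<Sum>i<n. (cmod (ev' (\<pi> i) - ev i))\<^sup>2) \<le> B"
proof -
  obtain \<rho> where \<rho>: "\<rho> permutes {..<n}" "\<And>i. i < n \<Longrightarrow> ev (\<rho> i) = R $$ (i, i)"
    using spectrum_of_similar_triangular[OF A] by blast
  have "(\<Sum>i<n. (cmod (ev' ((\<tau> \<circ> inv_into UNIV \<rho>) i) - ev i))\<^sup>2)
      = (\<Sum>i<n. (cmod (ev' ((\<tau> \<circ> inv_into UNIV \<rho>) (\<rho> i)) - ev (\<rho> i)))\<^sup>2)"
    using sum.permute[OF \<rho>(1)] by (simp add: comp_def)
  also have "\<dots> = (\<Sum>i<n. (cmod (ev' (\<tau> i) - R $$ (i, i)))\<^sup>2)"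
    using \<rho>(2) permutes_inverses(2)[OF \<rho>(1)] by (intro sum.cong) auto
  finally show ?thesis
    using \<tau> permutes_compose[OF permutes_inv[OF \<rho>(1)] \<tau>(1)] by metis
qed

text \<open>
  The diagonal scaling reduces the perturbation \<open>J + K\<close> to a perturbation
  of the diagonal of \<open>J\<close>, where \<open>e\<close> is still free.
\<close>
lemma graded_perturbation:
  assumes n: "0 < n" and J: "J \<in> carrier_mat n n" and K: "K \<in> carrier_mat n n"
    and s: "\<And>i. i < n \<Longrightarrow> s i < m"
    and J01: "\<And>i j. i < n \<Longrightarrow> j < n \<Longrightarrow> i \<noteq> j \<Longrightarrow> J $$ (i, j) = 0 \<or> J $$ (i, j) = 1 \<and> s j = Suc (s i)"
    and q: "(\<Sum>i<n. \<Sum>j<n. offdiag_sq J i j) = q"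
    and e: "0 < e" "e \<le> 1"
    and ev: "lists_spectrum ev (J + K)"
  shows "\<exists>\<pi>. \<pi> permutes {..<n} \<and> (\<Sum>i<n. (cmod (ev (\<pi> i) - J $$ (i, i)))\<^sup>2)
    \<le> real n * (q + 2 * sqrt q * mat_delta K + (mat_delta K)\<^sup>2 / (e ^ m)\<^sup>2) * e\<^sup>2
      + (cmod (mat_trace K))\<^sup>2 / real n"
proof -
  define F where "F = mat n n (\<lambda>(i, j). of_real (e ^ s j / e ^ s i) * ((if i = j then 0 else J $$ (i, j)) + K $$ (i, j)))"
  have trF: "mat_trace F = mat_trace K"
    unfolding F_def by (rule delta_sq_scaled_le(1)[OF n K s J01 q e])
  have deltaF: "(mat_delta F)\<^sup>2
      \<le> e\<^sup>2 * (q + 2 * sqrt q * mat_delta K + (mat_delta K)\<^sup>2 / (e ^ m)\<^sup>2)"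
    unfolding F_def by (rule delta_sq_scaled_le(2)[OF n K s J01 q e])
  have F: "F \<in> carrier_mat n n" by (simp add: F_def)
  have "similar_mat (J + K) (mat n n (\<lambda>(i, j). of_real (e ^ s j) / of_real (e ^ s i) * (J + K) $$ (i, j)))"
    using similar_mat_diag_scaling[of "J + K" n "\<lambda>i. of_real (e ^ s i)"] K e by simp
  also have "mat n n (\<lambda>(i, j). of_real (e ^ s j) / of_real (e ^ s i) * (J + K) $$ (i, j))
      = mat_diag n (\<lambda>i. J $$ (i, i)) + F"
    using J K e by (intro eq_matI) (auto simp: F_def mat_diag_def)
  finally have "lists_spectrum ev (mat_diag n (\<lambda>i. J $$ (i, i)) + F)"
    using ev by (rule lists_spectrum_similar)
  from diagonal_perturbation_spectrum[OF n F this]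
  obtain \<pi> where \<pi>: "\<pi> permutes {..<n}" and "(\<Sum>i<n. (cmod (ev (\<pi> i) - J $$ (i, i)))\<^sup>2)
      \<le> real n * (mat_delta F)\<^sup>2 + (cmod (mat_trace F))\<^sup>2 / real n" by blast
  moreover have "real n * (mat_delta F)\<^sup>2
      \<le> real n * (q + 2 * sqrt q * mat_delta K + (mat_delta K)\<^sup>2 / (e ^ m)\<^sup>2) * e\<^sup>2"
    using mult_left_mono[OF deltaF, of "real n"] by (simp only: mult.commute[of "e\<^sup>2"] mult.assoc of_nat_0_le_iff)
  ultimately show ?thesis using trF by (intro exI[of _ \<pi>]) auto
qed

theorem theorem3p1:
  fixes n :: nat
    and A E Q Qinv :: "complex mat"
    and blocks :: "(nat \<times> complex) list"
    and ev ev' :: "nat \<Rightarrow> complex"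
  defines "p \<equiv> length blocks"
    and "m \<equiv> Max (fst ` set blocks)"
    and "EQ \<equiv> Qinv * E * Q"
  assumes n: "n \<ge> 1"
    and A: "A \<in> carrier_mat n n"
    and E: "E \<in> carrier_mat n n"
    and Q: "Q \<in> carrier_mat n n"
    and Qinv: "Qinv \<in> carrier_mat n n" "inverts_mat Q Qinv" "inverts_mat Qinv Q"
    and blocks: "\<forall>(k, a) \<in> set blocks. k \<ge> 1" "sum_list (map fst blocks) = n"
    and fact_A: "A = Q * jordan_matrix blocks * Qinv"
    and ev: "lists_spectrum ev A"
    and ev': "lists_spectrum ev' (A + E)"
  shows "\<exists>\<pi>. \<pi> permutes {..<n} \<and>
    sqrt (\<Sum>i<n. (cmod (ev' (\<pi> i) - ev i))\<^sup>2) \<le>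
      (if frobenius_norm EQ < 1 then
         sqrt (real n * (real n - real p + 2 * sqrt (real n - real p) * mat_delta EQ
                         + (mat_delta EQ)\<^sup>2 / (frobenius_norm EQ)\<^sup>2)
                 * frobenius_norm EQ powr (2 / real m)
               + (cmod (mat_trace E))\<^sup>2 / real n)
       else
         sqrt (real n * (sqrt (real n - real p) + mat_delta EQ)\<^sup>2
               + (cmod (mat_trace E))\<^sup>2 / real n))"
proof -
  let ?J = "jordan_matrix blocks"
  define f where "f = frobenius_norm EQ"
  define \<delta> where "\<delta> = mat_delta EQ"
  define q where "q = real n - real p"
  have n0: "0 < n" using n by simp
  have J: "?J \<in> carrier_mat n n" using jordan_matrix_carrier[of blocks] blocks(2) by simp
  have EQ: "EQ \<in> carrier_mat n n" using E Q Qinv(1) by (auto simp: EQ_def)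
  have QQ: "Q * Qinv = 1\<^sub>m n" "Qinv * Q = 1\<^sub>m n"
    using Qinv Q by (simp_all add: inverts_mat_def)
  have upper: "upper_triangular ?J"
    using jordan_matrix_upper_triangular[of _ blocks] J by auto
  have simA: "similar_mat A ?J"
    using similar_mat_witI[OF QQ fact_A A J Q Qinv(1)] by (auto simp: similar_mat_def)
  have E_conj: "E = Q * EQ * Qinv"
  proof -
    have "Q * EQ * Qinv = (Q * Qinv) * E * (Q * Qinv)"
      using E Q Qinv(1)
      by (simp add: EQ_def assoc_mult_mat[of _ n n _ n _ n] mult_carrier_mat[of _ n n _ n])
    then show ?thesis using E QQ by simp
  qed
  have "A + E = Q * (?J + EQ) * Qinv"
    using Q Qinv(1) J EQ unfolding fact_A by (subst E_conj)
      (simp add: mult_add_distrib_mat[of _ n n _ n] add_mult_distrib_mat[of _ n n _ _ n] mult_carrier_mat[of _ n n _ n])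
  then have "similar_mat (A + E) (?J + EQ)"
    using similar_mat_witI[OF QQ, of "A + E" "?J + EQ"] A E J EQ Q Qinv(1) by (auto simp: similar_mat_def)
  then have ev'J: "lists_spectrum ev' (?J + EQ)" using ev' by (rule lists_spectrum_similar)
  have trE: "mat_trace EQ = mat_trace E"
    unfolding EQ_def by (rule mat_trace_conj[OF Q Qinv(1) E QQ(1)])
  obtain s where s: "\<And>i. i < n \<Longrightarrow> \<exists>(k, a) \<in> set blocks. s i < k"
    and J01: "\<And>i j. i < n \<Longrightarrow> j < n \<Longrightarrow> i \<noteq> j \<Longrightarrow> ?J $$ (i, j) = 0 \<or> ?J $$ (i, j) = 1 \<and> s j = Suc (s i)"
    and sum_q: "(\<Sum>i<n. \<Sum>j<n. offdiag_sq ?J i j) = q"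
    using jordan_matrix_grading[OF blocks(1)] unfolding blocks(2) q_def p_def by blast
  have sm: "s i < m" if "i < n" for i
  proof -
    from s[OF that] obtain k a where ka: "(k, a) \<in> set blocks" "s i < k" by auto
    then have "k \<le> m" unfolding m_def by (intro Max_ge) force+
    with ka show ?thesis by simp
  qed
  have m: "0 < m" using sm[OF n0] by simp
  have q0: "0 \<le> q" unfolding sum_q[symmetric] by (intro sum_nonneg) (simp add: offdiag_sq_def)
  have bound: "\<exists>\<pi>. \<pi> permutes {..<n} \<and> (\<Sum>i<n. (cmod (ev' (\<pi> i) - ev i))\<^sup>2)
      \<le> real n * (q + 2 * sqrt q * \<delta> + \<delta>\<^sup>2 / (e ^ m)\<^sup>2) * e\<^sup>2 + (cmod (mat_trace E))\<^sup>2 / real n"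
    if e: "0 < e" "e \<le> 1" for e
  proof -
    obtain \<tau> where "\<tau> permutes {..<n}" "(\<Sum>i<n. (cmod (ev' (\<tau> i) - ?J $$ (i, i)))\<^sup>2)
      \<le> real n * (q + 2 * sqrt q * \<delta> + \<delta>\<^sup>2 / (e ^ m)\<^sup>2) * e\<^sup>2 + (cmod (mat_trace E))\<^sup>2 / real n"
      using graded_perturbation[OF n0 J EQ sm J01 sum_q e ev'J] unfolding trE \<delta>_def by blast
    then show ?thesis by (rule spectral_matching[OF A simA upper ev])
  qed
  have "0 \<le> f" by (simp add: f_def frobenius_norm_def sum_nonneg)
  then consider "f = 0" | "0 < f" "f < 1" | "1 \<le> f" by linarith
  then show ?thesis
  proof cases
    case 1
    \<comment> \<open>scaling by \<open>e = f\<^bsup>1/m\<^esup> = 0\<close> is impossible, but \<open>E = 0\<close> and both listings rearrange the diagonal of \<open>J\<close>\<close>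
    have "(\<Sum>i<n. \<Sum>j<n. (cmod (EQ $$ (i, j)))\<^sup>2) = 0"
      using 1 frobenius_norm_sq[OF EQ] by (simp add: f_def)
    then have "EQ = 0\<^sub>m n n"
      using EQ by (intro eq_matI) (auto simp: sum_nonneg_eq_0_iff sum_nonneg)
    then have "E = 0\<^sub>m n n" using E_conj Q Qinv(1) by simp
    then have "lists_spectrum ev' A" using ev' A by simp
    from spectrum_of_similar_triangular[OF A simA upper this]
    obtain \<tau> where "\<tau> permutes {..<n}" "\<And>i. i < n \<Longrightarrow> ev' (\<tau> i) = ?J $$ (i, i)" by blast
    then have "\<exists>\<pi>. \<pi> permutes {..<n} \<and> (\<Sum>i<n. (cmod (ev' (\<pi> i) - ev i))\<^sup>2) \<le> 0"
      by (intro spectral_matching[OF A simA upper ev]) auto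
    then obtain \<pi> where \<pi>: "\<pi> permutes {..<n}" "(\<Sum>i<n. (cmod (ev' (\<pi> i) - ev i))\<^sup>2) \<le> 0" by blast
    then have "sqrt (\<Sum>i<n. (cmod (ev' (\<pi> i) - ev i))\<^sup>2) \<le> 0" by simp
    then show ?thesis using 1 \<pi>(1) by (intro exI[of _ \<pi>]) (auto simp: f_def intro: order_trans)
  next
    case 2
    define e where "e = f powr (1 / real m)"
    have e: "0 < e" "e \<le> 1" using 2 by (auto simp: e_def powr_le1)
    have em: "e ^ m = f" using 2 m by (simp add: e_def powr_realpow[symmetric] powr_powr)
    have e2: "e\<^sup>2 = f powr (2 / real m)"
      using 2 m by (simp add: e_def powr_realpow[symmetric] powr_powr)
    from bound[OF e] obtain \<pi> where \<pi>: "\<pi> permutes {..<n}" "(\<Sum>i<n. (cmod (ev' (\<pi> i) - ev i))\<^sup>2)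
      \<le> real n * (q + 2 * sqrt q * \<delta> + \<delta>\<^sup>2 / f\<^sup>2) * f powr (2 / real m) + (cmod (mat_trace E))\<^sup>2 / real n"
      unfolding em e2 by blast
    then have "sqrt (\<Sum>i<n. (cmod (ev' (\<pi> i) - ev i))\<^sup>2)
      \<le> sqrt (real n * (q + 2 * sqrt q * \<delta> + \<delta>\<^sup>2 / f\<^sup>2) * f powr (2 / real m) + (cmod (mat_trace E))\<^sup>2 / real n)"
      by simp
    then show ?thesis using 2 \<pi>(1) unfolding f_def \<delta>_def q_def by (intro exI[of _ \<pi>]) simp
  next
    case 3
    have "q + 2 * sqrt q * \<delta> + \<delta>\<^sup>2 = (sqrt q + \<delta>)\<^sup>2" using q0 by (simp add: power2_sum)
    with bound[of 1] obtain \<pi> where \<pi>: "\<pi> permutes {..<n}" "(\<Sum>i<n. (cmod (ev' (\<pi> i) - ev i))\<^sup>2)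
      \<le> real n * (sqrt q + \<delta>)\<^sup>2 + (cmod (mat_trace E))\<^sup>2 / real n"
      by auto
    then have "sqrt (\<Sum>i<n. (cmod (ev' (\<pi> i) - ev i))\<^sup>2)
      \<le> sqrt (real n * (sqrt q + \<delta>)\<^sup>2 + (cmod (mat_trace E))\<^sup>2 / real n)"
      by simp
    then show ?thesis using 3 \<pi>(1) unfolding f_def \<delta>_def q_def by (intro exI[of _ \<pi>]) simp
  qed
qed

end
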